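(* Let $\mathsf{KF}^\circ$ be any one of the twelve theories $\mathsf{KF}_\star{\upharpoonright}$, $\mathsf{KF}_\star^{\mathsf{int}}$, $\mathsf{KF}_\star$, where $\mathsf{KF}_\star\in\{\mathsf{KF},\mathsf{KF_{cs}},\mathsf{KF_{cp}},\mathsf{KF_S}\}$. Let $\Gamma,\Delta$ be finite sets of $\mathcal L_T$-sentences with $\langle\Gamma,\Delta\rangle\in\mathsf{KF}^\circ\mathsf{SI}$, i.e. $\mathsf{KF}^\circ\vdash T\ulcorner\Gamma\urcorner\Rightarrow T\ulcorner\Delta\urcorner$. Then there is a $\mathsf{KF}^\circ$-derivation $\mathcal D$ of $T\ulcorner\Gamma\urcorner\Rightarrow T\ulcorner\Delta\urcorner$ such that for each node $d$ of $\mathcal D$, $d\in\mathsf{KF}^\circ\mathsf{SI}$.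
   Context: **Language.** $\mathcal L_{\mathsf{PA}}$ is the language of first-order Peano arithmetic $\mathsf{PA}$ (logical symbols $=,\neg,\wedge,\forall$, the others being defined), in practice a definitional extension with symbols for the primitive recursive relations and functions below; $\mathcal L_T$ is $\mathcal L_{\mathsf{PA}}$ plus a unary predicate $T$. A canonical Gödel numbering is fixed; $\ulcorner e\urcorner$ is the term for the Gödel number (gn) of $e$. $\mathsf{ClTerm}(x)$, $\mathsf{Var}(x)$, $\mathsf{Sent}(x)$, $\mathsf{Fml}_1(x)$ say that $x$ is the gn of a closed term, a variable, an $\mathcal L_T$-sentence, an $\mathcal L_T$-formula with at most one free variable. $\underset{.}{\neg},\underset{.}{\wedge},\underset{.}{=},\underset{.}{\forall},\underset{.}{T}$ represent the syntactic operations on gn's ($\underset{.}{T}$ maps $\#t$ to $\#T(t)$; $\underset{.}{\forall}v.x$ is formal quantification); $\mathsf{num}(x)=\dot x$ is the gn of the $x$-th numeral; $x[y/v]$ also denotes formal substitution; $\mathsf{val}$ is evaluation of closed terms. $u'$ is the successor of $u$. For a finite set $\Gamma$ of sentences, $T\ulcorner\Gamma\urcorner=\{T\ulcorner\gamma\urcorner:\gamma\in\Gamma\}$; for a formula $\varphi(\vec x)$, $\ulcorner\varphi(\dot{\vec x})\urcorner$ is the term for the formal result of substituting the numerals of $\vec x$ for the free variables, and $T\ulcorner\Gamma(\dot{\vec x})\urcorner$ is defined elementwise. **Sequents.** A sequent $\Gamma\Rightarrow\Delta$ is a pair of finite sets of $\mathcal L_T$-formulae. A derivation is a tree with nodes labelled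 by sequents, whose root is labelled by the sequent derived. A literal is an atomic formula or the negation of one. Rules are written "premises / conclusion"; $u$ always denotes an eigenvariable, $t,s$ arbitrary terms. **Classical logic.** $\mathsf{CL}_=$ has initial sequents $\varphi,\Gamma\Rightarrow\Delta,\varphi$ ($\varphi$ literal) and the rules: (Cut) $\Gamma\Rightarrow\Delta,\varphi$ and $\varphi,\Gamma'\Rightarrow\Delta'$ / $\Gamma',\Gamma\Rightarrow\Delta,\Delta'$; ($\wedge$L) $\varphi,\psi,\Gamma\Rightarrow\Delta$ / $\varphi\wedge\psi,\Gamma\Rightarrow\Delta$; ($\wedge$R) $\Gamma\Rightarrow\Delta,\varphi$ and $\Gamma\Rightarrow\Delta,\psi$ / $\Gamma\Rightarrow\Delta,\varphi\wedge\psi$; ($\forall$L) $\varphi[t/v],\Gamma\Rightarrow\Delta$ / $\forall v\varphi,\Gamma\Rightarrow\Delta$; ($\forall$R) $\Gamma\Rightarrow\Delta,\varphi[u/v]$ / $\Gamma\Rightarrow\Delta,\forall v\varphi$; ($\neg$L) $\Gamma\Rightarrow\Delta,\varphi$ / $\neg\varphi,\Gamma\Rightarrow\Delta$; ($\neg$R) $\varphi,\Gamma\Rightarrow\Delta$ / $\Gamma\Rightarrow\Delta,\neg\varphi$; (Ref) $t=t,\Gamma\Rightarrow\Delta$ / $\Gamma\Rightarrow\Delta$; (RepL) $\varphi(t),\Gamma\Rightarrow\Delta$ / $s=t,\varphi(s),\Gamma\Rightarrow\Delta$ for literals $\varphi$. **Induction.** ($\mathsf{IND}$) $\Gamma,\varphi(u)\Rightarrow\varphi(u'),\Delta$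 / $\Gamma,\varphi(\mathsf 0)\Rightarrow\varphi(t),\Delta$, for $\varphi\in\mathcal L_T$, $u$ not free in $\Gamma,\Delta,\varphi(\mathsf 0)$. ($\mathsf{IND}^{\mathsf{int}}$) $\mathsf{Fml}_1(x),Tx[\dot u/v],\Gamma\Rightarrow\Delta,Tx[\dot{u'}/v]$ / $Tx[\mathsf{num}(\mathsf 0)/v],\Gamma\Rightarrow\Delta,Tx[\dot z/v]$, $z$ an arbitrary term. **Truth axioms** (initial sequents): ($T{=}$) $\mathsf{ClTerm}(x),\mathsf{ClTerm}(y),\mathsf{val}(x)=\mathsf{val}(y),\Gamma\Rightarrow\Delta,T(x\underset{.}{=}y)$ and $\mathsf{ClTerm}(x),\mathsf{ClTerm}(y),T(x\underset{.}{=}y),\Gamma\Rightarrow\Delta,\mathsf{val}(x)=\mathsf{val}(y)$; ($T\neg{=}$) the same two with $\neg(\mathsf{val}(x)=\mathsf{val}(y))$ and $T(\underset{.}{\neg}(x\underset{.}{=}y))$ in place of $\mathsf{val}(x)=\mathsf{val}(y)$ and $T(x\underset{.}{=}y)$; ($T\mathsf{Sent}$) $Tx,\Gamma\Rightarrow\Delta,\mathsf{Sent}(x)$; ($\mathsf{Reg1}$) $\mathsf{Var}(z),\mathsf{ClTerm}(y),\mathsf{Sent}(\underset{.}{\forall}z.x),Tx[y/z],\Gamma\Rightarrow\Delta,Tx[\mathsf{num}(\mathsf{val}(y))/z]$; ($\mathsf{Reg2}$) the same with the two $T$-formulae interchanged. **Truth rules.** (In each line the first listed formula also stands in the antecedent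 of all premises and of the conclusion.) $\mathsf{ClTerm}(x)$: $T(\mathsf{val}(x)),\Gamma\Rightarrow\Delta$ / $T(\underset{.}{T}x),\Gamma\Rightarrow\Delta$; and $\Gamma\Rightarrow\Delta,T(\mathsf{val}(x))$ / $\Gamma\Rightarrow\Delta,T(\underset{.}{T}x)$. $\mathsf{ClTerm}(x)$: $T(\underset{.}{\neg}\mathsf{val}(x)),\Gamma\Rightarrow\Delta$ and $\neg\mathsf{Sent}(\mathsf{val}(x)),\Gamma\Rightarrow\Delta$ / $T(\underset{.}{\neg}\underset{.}{T}x),\Gamma\Rightarrow\Delta$; and $\Gamma\Rightarrow\Delta,T(\underset{.}{\neg}\mathsf{val}(x)),\neg\mathsf{Sent}(\mathsf{val}(x))$ / $\Gamma\Rightarrow\Delta,T(\underset{.}{\neg}\underset{.}{T}x)$. $\mathsf{Sent}(x)$: $T(x),\Gamma\Rightarrow\Delta$ / $T(\underset{.}{\neg}\underset{.}{\neg}x),\Gamma\Rightarrow\Delta$; and $\Gamma\Rightarrow\Delta,T(x)$ / $\Gamma\Rightarrow\Delta,T(\underset{.}{\neg}\underset{.}{\neg}x)$. $\mathsf{Sent}(x\underset{.}{\wedge}y)$: $T(x),T(y),\Gamma\Rightarrow\Delta$ / $T(x\underset{.}{\wedge}y),\Gamma\Rightarrow\Delta$; and $\Gamma\Rightarrow\Delta,T(x)$ and $\Gamma\Rightarrow\Delta,T(y)$ / $\Gamma\Rightarrow\Delta,T(x\underset{.}{\wedge}y)$. $\mathsf{Sent}(x\underset{.}{\wedge}y)$: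 $T(\underset{.}{\neg}x),\Gamma\Rightarrow\Delta$ and $T(\underset{.}{\neg}y),\Gamma\Rightarrow\Delta$ / $T(\underset{.}{\neg}(x\underset{.}{\wedge}y)),\Gamma\Rightarrow\Delta$; and $\Gamma\Rightarrow\Delta,T(\underset{.}{\neg}x),T(\underset{.}{\neg}y)$ / $\Gamma\Rightarrow\Delta,T(\underset{.}{\neg}(x\underset{.}{\wedge}y))$. $\mathsf{Sent}(\underset{.}{\forall}v.x)$: $\forall y\,T(x[\dot y/v]),\Gamma\Rightarrow\Delta$ / $T(\underset{.}{\forall}v.x),\Gamma\Rightarrow\Delta$; and $\Gamma\Rightarrow\Delta,\forall z\,T(x[\dot z/v])$ / $\Gamma\Rightarrow\Delta,T(\underset{.}{\forall}v.x)$. $\mathsf{Sent}(\underset{.}{\forall}v.x)$: $\neg\forall z\neg T(\underset{.}{\neg}x[\dot z/v]),\Gamma\Rightarrow\Delta$ / $T(\underset{.}{\neg}\underset{.}{\forall}v.x),\Gamma\Rightarrow\Delta$; and $\Gamma\Rightarrow\Delta,\neg\forall z\neg T(\underset{.}{\neg}x[\dot z/v])$ / $\Gamma\Rightarrow\Delta,T(\underset{.}{\neg}\underset{.}{\forall}v.x)$. **$\mathsf{KF}$-like theories.** $\mathsf{KF}$ is $\mathsf{CL}_=$ plus $\Rightarrow\varphi$ for $\varphi$ an axiom of $\mathsf{PA}$, ($\mathsf{IND}$), the truth axioms ($T{=}$), ($T\neg{=}$), ($T\mathsf{Sent}$), ($\mathsf{Reg1}$), ($\mathsf{Reg2}$),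 and the truth rules (those for $\underset{.}{T}x$, $\underset{.}{\neg}\underset{.}{T}x$, $\underset{.}{\neg}\underset{.}{\neg}x$, $x\underset{.}{\wedge}y$, $\underset{.}{\neg}(x\underset{.}{\wedge}y)$, $\underset{.}{\forall}v.x$ and $\underset{.}{\neg}\underset{.}{\forall}v.x$). $\mathsf{KF_{cs}}$, $\mathsf{KF_{cp}}$, $\mathsf{KF_S}$ add to $\mathsf{KF}$, respectively, the initial sequents $\mathsf{Sent}(x),T(\underset{.}{\neg}x),\Gamma\Rightarrow\Delta,\neg T(x)$; $\mathsf{Sent}(x),\neg T(x),\Gamma\Rightarrow\Delta,T(\underset{.}{\neg}x)$; and $\mathsf{Sent}(x),\mathsf{Sent}(y),T(x),T(\underset{.}{\neg}x),\Gamma\Rightarrow\Delta,T(y),T(\underset{.}{\neg}y)$. For each such theory $\mathsf{KF}_\star$, $\mathsf{KF}_\star{\upharpoonright}$ restricts ($\mathsf{IND}$) to $\mathcal L_{\mathsf{PA}}$-formulae, and $\mathsf{KF}_\star^{\mathsf{int}}$ is $\mathsf{KF}_\star{\upharpoonright}$ with the restricted ($\mathsf{IND}$) replaced by ($\mathsf{IND}^{\mathsf{int}}$). **Significant inferences.** $\mathsf{KF}^\circ\mathsf{SI}=\{\langle\Gamma,\Delta\rangle:\mathsf{KF}^\circ\vdash T\ulcorner\Gamma\urcorner\Rightarrow T\ulcorner\Delta\urcorner\}$ for finite sets $\Gamma,\Delta$ of sentences. A node $d$ labelled $\Gamma'\Rightarrow\Delta'$ belongs to $\mathsf{KF}^\circ\mathsf{SI}$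 if $\langle\Gamma',\Delta'\rangle$ does; if $\Gamma',\Delta'$ have free variables among $\vec x$, this means $\mathsf{KF}^\circ\vdash T\ulcorner\Gamma'(\dot{\vec x})\urcorner\Rightarrow T\ulcorner\Delta'(\dot{\vec x})\urcorner$. *)

theory Defs
  imports Main "HOL-Library.FSet" "HOL-Library.Nat_Bijection"
begin

section \<open>The language\<close>

text \<open>
  Arithmetic is formulated with zero, successor, addition, multiplication and finitely many further
  primitive recursive function symbols.  A primitive recursive relation is given by its
  characteristic function (value 1 if the relation holds, 0 otherwise), so identity and \<open>T\<close> are the
  only predicates, and the truth axioms for identities settle all atomic arithmetical sentences.

  Intended meaning of the symbols:
  \<^item> \<open>NumF\<close>: Goedel number of the \<open>x\<close>-th numeral;
  \<^item> \<open>VarF\<close>, \<open>TermF\<close>, \<open>FmlF\<close>: being the Goedel number of a variable, a term, an \<open>L\<^sub>T\<close>-formula;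
  \<^item> \<open>ConsF\<close>: a pairing of the numbers with the positive numbers;
  \<^item> \<open>MemF\<close>: membership \<open>x \<in> c\<close>, where \<open>c\<close> is read as a list built by \<open>ConsF\<close> from 0;
  \<^item> \<open>SubF\<close>: formal substitution \<open>x[y/v]\<close>, with \<open>y\<close> and \<open>v\<close> passed as the one argument
    \<open>cons y v\<close>;
  \<^item> \<open>FreeF\<close>: the variable \<open>w\<close> occurs free in \<open>x\<close>;
  \<^item> \<open>CntF\<close>: the number of variables with index below \<open>n\<close> that occur free in \<open>x\<close>.

  Evaluation of closed terms cannot be a function symbol of the language whose terms it
  evaluates (diagonalisation would give a closed term \<open>s\<close> whose value is its own value plus 1);
  it is a defined functional relation, \<open>Val\<close> below.
\<close>

datatype fn1 = SucF | NumF | VarF | TermF | FmlF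
datatype fn2 = AddF | MulF | ConsF | MemF | SubF | FreeF | CntF

datatype tm = V nat | Zero | F1 fn1 tm | F2 fn2 tm tm

datatype fm = Eq tm tm | Tr tm | Neg fm | And fm fm | All nat fm

abbreviation "Or \<phi> \<psi> \<equiv> Neg (And (Neg \<phi>) (Neg \<psi>))"
abbreviation "Imp \<phi> \<psi> \<equiv> Neg (And \<phi> (Neg \<psi>))"
abbreviation "Iff \<phi> \<psi> \<equiv> And (Imp \<phi> \<psi>) (Imp \<psi> \<phi>)"
abbreviation "Exi i \<phi> \<equiv> Neg (All i (Neg \<phi>))"
abbreviation "Bot \<equiv> Neg (Eq Zero Zero)"

definition Disj :: "fm list \<Rightarrow> fm" where
  "Disj \<phi>s = foldr (\<lambda>\<phi> \<psi>. Or \<phi> \<psi>) \<phi>s Bot"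

abbreviation "Sc \<equiv> F1 SucF"

definition numeral_tm :: "nat \<Rightarrow> tm" where
  "numeral_tm n = (Sc ^^ n) Zero"

primrec tv :: "tm \<Rightarrow> nat set" where
  "tv (V i) = {i}"
| "tv Zero = {}"
| "tv (F1 f t) = tv t"
| "tv (F2 f s t) = tv s \<union> tv t"

primrec fv :: "fm \<Rightarrow> nat set" where
  "fv (Eq s t) = tv s \<union> tv t"
| "fv (Tr t) = tv t"
| "fv (Neg \<phi>) = fv \<phi>"
| "fv (And \<phi> \<psi>) = fv \<phi> \<union> fv \<psi>"
| "fv (All i \<phi>) = fv \<phi> - {i}"

definition sentence :: "fm \<Rightarrow> bool" where
  "sentence \<phi> \<longleftrightarrow> fv \<phi> = {}"

primrec arithmetical :: "fm \<Rightarrow> bool" where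
  "arithmetical (Eq s t) = True"
| "arithmetical (Tr t) = False"
| "arithmetical (Neg \<phi>) = arithmetical \<phi>"
| "arithmetical (And \<phi> \<psi>) = (arithmetical \<phi> \<and> arithmetical \<psi>)"
| "arithmetical (All i \<phi>) = arithmetical \<phi>"

definition atomic :: "fm \<Rightarrow> bool" where
  "atomic \<phi> \<longleftrightarrow> (\<exists>s t. \<phi> = Eq s t) \<or> (\<exists>t. \<phi> = Tr t)"

definition literal :: "fm \<Rightarrow> bool" where
  "literal \<phi> \<longleftrightarrow> atomic \<phi> \<or> (\<exists>\<psi>. atomic \<psi> \<and> \<phi> = Neg \<psi>)"

text \<open>\<open>subst \<phi> v t\<close> does not rename bound variables, so it is \<open>\<phi>[t/v]\<close> only if
  \<open>free_for t v \<phi>\<close>; the rules below carry this as a side condition.\<close>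

primrec tsubst :: "tm \<Rightarrow> nat \<Rightarrow> tm \<Rightarrow> tm" where
  "tsubst (V i) v t = (if i = v then t else V i)"
| "tsubst Zero v t = Zero"
| "tsubst (F1 f s) v t = F1 f (tsubst s v t)"
| "tsubst (F2 f r s) v t = F2 f (tsubst r v t) (tsubst s v t)"

primrec subst :: "fm \<Rightarrow> nat \<Rightarrow> tm \<Rightarrow> fm" where
  "subst (Eq r s) v t = Eq (tsubst r v t) (tsubst s v t)"
| "subst (Tr s) v t = Tr (tsubst s v t)"
| "subst (Neg \<phi>) v t = Neg (subst \<phi> v t)"
| "subst (And \<phi> \<psi>) v t = And (subst \<phi> v t) (subst \<psi> v t)"
| "subst (All i \<phi>) v t = (if i = v then All i \<phi> else All i (subst \<phi> v t))"

primrec free_for :: "tm \<Rightarrow> nat \<Rightarrow> fm \<Rightarrow> bool" where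
  "free_for t v (Eq r s) = True"
| "free_for t v (Tr s) = True"
| "free_for t v (Neg \<phi>) = free_for t v \<phi>"
| "free_for t v (And \<phi> \<psi>) = (free_for t v \<phi> \<and> free_for t v \<psi>)"
| "free_for t v (All i \<phi>) = (v \<notin> fv (All i \<phi>) \<or> (i \<notin> tv t \<and> free_for t v \<phi>))"


section \<open>Goedel numbering\<close>

text \<open>
  Every number is 0 or \<open>cons h b\<close> for unique \<open>h\<close> and \<open>b\<close>.  Variables are \<open>cons 0 i\<close>, the
  constant 0 is \<open>cons 1 0\<close>, and every compound expression is \<open>cons h (cons l r)\<close>, where \<open>h > 1\<close>
  identifies its outermost symbol (\<open>r = 0\<close> for unary symbols).
\<close>

definition cons :: "nat \<Rightarrow> nat \<Rightarrow> nat" where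
  "cons a b = Suc (prod_encode (a, b))"

fun tag1 :: "fn1 \<Rightarrow> nat" where
  "tag1 SucF = 2" | "tag1 NumF = 3" | "tag1 VarF = 4" | "tag1 TermF = 5" | "tag1 FmlF = 6"

fun tag2 :: "fn2 \<Rightarrow> nat" where
  "tag2 AddF = 7" | "tag2 MulF = 8" | "tag2 ConsF = 9" | "tag2 MemF = 10" | "tag2 SubF = 11"
| "tag2 FreeF = 12" | "tag2 CntF = 13"

abbreviation (input) "tagZ \<equiv> 1 :: nat"
abbreviation (input) "tagEq \<equiv> 14 :: nat"
abbreviation (input) "tagT \<equiv> 15 :: nat"
abbreviation (input) "tagNeg \<equiv> 16 :: nat"
abbreviation (input) "tagAnd \<equiv> 17 :: nat"
abbreviation (input) "tagAll \<equiv> 18 :: nat"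

abbreviation node :: "nat \<Rightarrow> nat \<Rightarrow> nat \<Rightarrow> nat" where
  "node h l r \<equiv> cons h (cons l r)"

primrec gn_tm :: "tm \<Rightarrow> nat" where
  "gn_tm (V i) = cons 0 i"
| "gn_tm Zero = cons tagZ 0"
| "gn_tm (F1 f t) = node (tag1 f) (gn_tm t) 0"
| "gn_tm (F2 f s t) = node (tag2 f) (gn_tm s) (gn_tm t)"

primrec gn :: "fm \<Rightarrow> nat" where
  "gn (Eq s t) = node tagEq (gn_tm s) (gn_tm t)"
| "gn (Tr t) = node tagT (gn_tm t) 0"
| "gn (Neg \<phi>) = node tagNeg (gn \<phi>) 0"
| "gn (And \<phi> \<psi>) = node tagAnd (gn \<phi>) (gn \<psi>)"
| "gn (All i \<phi>) = node tagAll (gn_tm (V i)) (gn \<phi>)"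

definition quote_tm :: "tm \<Rightarrow> tm" where
  "quote_tm t = numeral_tm (gn_tm t)"

definition quote_fm :: "fm \<Rightarrow> tm" where
  "quote_fm \<phi> = numeral_tm (gn \<phi>)"


section \<open>Formalised syntax\<close>

abbreviation "One \<equiv> Sc Zero"
abbreviation "Add \<equiv> F2 AddF"
abbreviation "Mul \<equiv> F2 MulF"
abbreviation "Pr \<equiv> F2 ConsF"

abbreviation Node :: "tm \<Rightarrow> tm \<Rightarrow> tm \<Rightarrow> tm" where
  "Node h l r \<equiv> Pr h (Pr l r)"

abbreviation is_tag :: "tm \<Rightarrow> nat \<Rightarrow> fm" where
  "is_tag h k \<equiv> Eq h (numeral_tm k)"

abbreviation num :: "tm \<Rightarrow> tm" where "num x \<equiv> F1 NumF x"

abbreviation Sub :: "tm \<Rightarrow> tm \<Rightarrow> tm \<Rightarrow> tm" where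
  "Sub x y v \<equiv> F2 SubF x (Pr y v)"

abbreviation deq :: "tm \<Rightarrow> tm \<Rightarrow> tm" where "deq x y \<equiv> Node (numeral_tm tagEq) x y"
abbreviation dtr :: "tm \<Rightarrow> tm" where "dtr x \<equiv> Node (numeral_tm tagT) x Zero"
abbreviation dneg :: "tm \<Rightarrow> tm" where "dneg x \<equiv> Node (numeral_tm tagNeg) x Zero"
abbreviation dand :: "tm \<Rightarrow> tm \<Rightarrow> tm" where "dand x y \<equiv> Node (numeral_tm tagAnd) x y"
abbreviation dall :: "tm \<Rightarrow> tm \<Rightarrow> tm" where "dall v x \<equiv> Node (numeral_tm tagAll) v x"

abbreviation IsVar :: "tm \<Rightarrow> fm" where "IsVar x \<equiv> Eq (F1 VarF x) One"
abbreviation IsTerm :: "tm \<Rightarrow> fm" where "IsTerm x \<equiv> Eq (F1 TermF x) One"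
abbreviation IsFml :: "tm \<Rightarrow> fm" where "IsFml x \<equiv> Eq (F1 FmlF x) One"
abbreviation Mem :: "tm \<Rightarrow> tm \<Rightarrow> fm" where "Mem x c \<equiv> Eq (F2 MemF x c) One"
abbreviation Free :: "tm \<Rightarrow> tm \<Rightarrow> fm" where "Free w x \<equiv> Eq (F2 FreeF w x) One"

text \<open>Since \<open>cons 0 i > i\<close> and \<open>cons a b > a, b\<close>, a variable occurring in an expression has an
  index below the code \<open>x\<close> of the expression; so \<open>CntF x x\<close> counts all its free variables.\<close>

definition ClTerm :: "tm \<Rightarrow> fm" where
  "ClTerm x = And (IsTerm x) (Eq (F2 CntF x x) Zero)"

definition Sent :: "tm \<Rightarrow> fm" where
  "Sent x = And (IsFml x) (Eq (F2 CntF x x) Zero)"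

definition Fml1 :: "tm \<Rightarrow> fm" where
  "Fml1 x = And (IsFml x) (Or (Eq (F2 CntF x x) Zero) (Eq (F2 CntF x x) One))"

definition fresh :: "tm list \<Rightarrow> nat" where
  "fresh ts = (LEAST i. \<forall>t\<in>set ts. \<forall>j\<in>tv t. j < i)"

text \<open>\<open>EvalList c\<close> says that the list \<open>c\<close> consists of pairs (term, value) and contains, with each
  pair, pairs for the immediate subterms from which its value is obtained by one step of the
  evaluation.  \<open>Val x y\<close> is the graph of evaluation on closed terms.\<close>

definition EvalList :: "nat \<Rightarrow> fm" where
  "EvalList c =
    (let t = c + 1; y = c + 2; t1 = c + 3; y1 = c + 4; t2 = c + 5; y2 = c + 6 in
     All t (All y (Imp (Mem (Pr (V t) (V y)) (V c))
       (Disj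
         (And (Eq (V t) (quote_tm Zero)) (Eq (V y) Zero)
          # map (\<lambda>f. Exi t1 (Exi y1
                (And (Mem (Pr (V t1) (V y1)) (V c))
                (And (Eq (V t) (Node (numeral_tm (tag1 f)) (V t1) Zero))
                     (Eq (V y) (F1 f (V y1)))))))
              [SucF, NumF, VarF, TermF, FmlF]
          @ map (\<lambda>f. Exi t1 (Exi y1 (Exi t2 (Exi y2
                (And (And (Mem (Pr (V t1) (V y1)) (V c)) (Mem (Pr (V t2) (V y2)) (V c)))
                (And (Eq (V t) (Node (numeral_tm (tag2 f)) (V t1) (V t2)))
                     (Eq (V y) (F2 f (V y1) (V y2)))))))))
              [AddF, MulF, ConsF, MemF, SubF, FreeF, CntF])))))"

definition Val :: "tm \<Rightarrow> tm \<Rightarrow> fm" where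
  "Val x y = (let c = fresh [x, y] in Exi c (And (EvalList c) (Mem (Pr x y) (V c))))"

text \<open>A formula \<open>A(val(x))\<close> is short for \<open>\<exists>z (Val(x,z) \<and> A(z))\<close>.  The list \<open>ts\<close> contains the
  other terms occurring in \<open>A\<close>, which \<open>z\<close> must avoid.\<close>

definition with_val :: "tm \<Rightarrow> tm list \<Rightarrow> (tm \<Rightarrow> fm) \<Rightarrow> fm" where
  "with_val x ts A = (let z = fresh (x # ts) in Exi z (And (Val x (V z)) (A (V z))))"

definition eq_val :: "tm \<Rightarrow> tm \<Rightarrow> fm" where
  "eq_val x y = with_val x [y] (\<lambda>a. with_val y [a] (\<lambda>b. Eq a b))"


section \<open>The axioms of Peano arithmetic\<close>

text \<open>Besides the axioms for successor, addition and multiplication there are the recursion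
  equations of the other symbols; \<open>ConsF\<close> is the function \<open>cons\<close>, defined by recursion
  along Cantor's enumeration of pairs.\<close>

definition defining_axioms :: "fm set" where
  "defining_axioms =
    (let x = V 0; y = V 1; z = V 2; h = V 3; l = V 4; r = V 5; v = V 6; w = V 7;
         S = Sc; K = numeral_tm; var = (\<lambda>i. Pr Zero i);
         mem = F2 MemF; free = F2 FreeF; cnt = F2 CntF
     in
     { Neg (Eq (S x) Zero),
       Imp (Eq (S x) (S y)) (Eq x y),
       Eq (Add x Zero) x,
       Eq (Add x (S y)) (S (Add x y)),
       Eq (Mul x Zero) Zero,
       Eq (Mul x (S y)) (Add (Mul x y) x),

       Eq (Pr Zero Zero) One,
       Eq (Pr Zero (S y)) (S (Pr y Zero)),
       Eq (Pr (S x) y) (S (Pr x (S y))),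

       Eq (mem x Zero) Zero,
       Eq (mem x (Pr x z)) One,
       Imp (Neg (Eq x y)) (Eq (mem x (Pr y z)) (mem x z)),

       Eq (num Zero) (quote_tm Zero),
       Eq (num (S x)) (Node (K (tag1 SucF)) (num x) Zero),

       Eq (F2 SubF x Zero) Zero,
       Eq (Sub Zero y v) Zero,
       Eq (Sub (var z) y (var z)) y,
       Imp (Neg (Eq (var z) v)) (Eq (Sub (var z) y v) (var z)),
       Eq (Sub (Pr (S h) Zero) y v) (Pr (S h) Zero),
       Eq (Sub (dall v r) y v) (dall v r),
       Imp (Neg (And (is_tag (S h) tagAll) (Eq l v)))
         (Eq (Sub (Node (S h) l r) y v) (Node (S h) (Sub l y v) (Sub r y v))),

       Or (Eq (free w x) Zero) (Eq (free w x) One),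
       Eq (free w Zero) Zero,
       Iff (Free w (var z)) (Eq w (var z)),
       Eq (free w (Pr (S h) Zero)) Zero,
       Eq (free w (dall w r)) Zero,
       Imp (Neg (And (is_tag (S h) tagAll) (Eq l w)))
         (Iff (Free w (Node (S h) l r)) (Or (Free w l) (Free w r))),

       Eq (cnt Zero x) Zero,
       Eq (cnt (S y) x) (Add (cnt y x) (free (var y) x)),

       Eq (F1 VarF Zero) Zero,
       Eq (F1 VarF (var z)) One,
       Eq (F1 VarF (Pr (S h) z)) Zero,

       Or (Eq (F1 TermF x) Zero) (Eq (F1 TermF x) One),
       Eq (F1 TermF Zero) Zero,
       Eq (F1 TermF (var z)) One,
       Iff (IsTerm (Pr (S h) Zero)) (is_tag (S h) tagZ),
       Iff (IsTerm (Node (S h) l r))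
         (Or (And (Disj (map (\<lambda>f. is_tag (S h) (tag1 f)) [SucF, NumF, VarF, TermF, FmlF]))
                  (And (IsTerm l) (Eq r Zero)))
             (And (Disj (map (\<lambda>f. is_tag (S h) (tag2 f))
                         [AddF, MulF, ConsF, MemF, SubF, FreeF, CntF]))
                  (And (IsTerm l) (IsTerm r)))),

       Or (Eq (F1 FmlF x) Zero) (Eq (F1 FmlF x) One),
       Eq (F1 FmlF Zero) Zero,
       Eq (F1 FmlF (var z)) Zero,
       Eq (F1 FmlF (Pr (S h) Zero)) Zero,
       Iff (IsFml (Node (S h) l r))
         (Disj [And (is_tag (S h) tagEq) (And (IsTerm l) (IsTerm r)),
                And (is_tag (S h) tagT) (And (IsTerm l) (Eq r Zero)),
                And (is_tag (S h) tagNeg) (And (IsFml l) (Eq r Zero)),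
                And (is_tag (S h) tagAnd) (And (IsFml l) (IsFml r)),
                And (is_tag (S h) tagAll) (And (IsVar l) (IsFml r))]) })"

definition univ_closure :: "fm \<Rightarrow> fm" where
  "univ_closure \<phi> = foldr All (sorted_list_of_set (fv \<phi>)) \<phi>"

inductive pa_axiom :: "fm \<Rightarrow> bool" where
  defining: "\<phi> \<in> defining_axioms \<Longrightarrow> pa_axiom (univ_closure \<phi>)"
| induction: "arithmetical \<phi> \<Longrightarrow>
    pa_axiom (univ_closure
      (Imp (And (subst \<phi> i Zero) (All i (Imp \<phi> (subst \<phi> i (Sc (V i)))))) (All i \<phi>)))"


section \<open>The sequent calculi\<close>

datatype sequent = Seq "fm fset" "fm fset"  (infix "\<Turnstile>" 50)

definition fvs :: "fm fset \<Rightarrow> nat set" where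
  "fvs \<Gamma> = (\<Union>\<phi>\<in>fset \<Gamma>. fv \<phi>)"

datatype truth_theory = KF | KFcs | KFcp | KFS
datatype induction_version = Restricted | Internal | Full

text \<open>\<open>inference K I Ps S\<close>: the list \<open>Ps\<close> of premises and the conclusion \<open>S\<close> form an instance of a
  rule (an initial sequent if \<open>Ps = []\<close>) of the extension \<open>K\<close> of \<open>KF\<close> with version \<open>I\<close> of
  induction.  In the axioms and rules for truth, the letters \<open>x\<close>, \<open>y\<close>, \<open>z\<close>, \<open>v\<close> range over arbitrary
  terms.\<close>

inductive inference :: "truth_theory \<Rightarrow> induction_version \<Rightarrow> sequent list \<Rightarrow> sequent \<Rightarrow> bool"
  for K :: truth_theory and I :: induction_version where
  \<comment> \<open>classical logic with identity\<close>
  Init: "literal \<phi> \<Longrightarrow> inference K I [] (finsert \<phi> \<Gamma> \<Turnstile> finsert \<phi> \<Delta>)"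
| Cut: "inference K I [\<Gamma> \<Turnstile> finsert \<phi> \<Delta>, finsert \<phi> \<Gamma>' \<Turnstile> \<Delta>'] (\<Gamma>' |\<union>| \<Gamma> \<Turnstile> \<Delta> |\<union>| \<Delta>')"
| AndL: "inference K I [{|\<phi>, \<psi>|} |\<union>| \<Gamma> \<Turnstile> \<Delta>] (finsert (And \<phi> \<psi>) \<Gamma> \<Turnstile> \<Delta>)"
| AndR: "inference K I [\<Gamma> \<Turnstile> finsert \<phi> \<Delta>, \<Gamma> \<Turnstile> finsert \<psi> \<Delta>] (\<Gamma> \<Turnstile> finsert (And \<phi> \<psi>) \<Delta>)"
| AllL: "free_for t v \<phi> \<Longrightarrow>
    inference K I [finsert (subst \<phi> v t) \<Gamma> \<Turnstile> \<Delta>] (finsert (All v \<phi>) \<Gamma> \<Turnstile> \<Delta>)"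
| AllR: "free_for (V u) v \<phi> \<Longrightarrow> u \<notin> fvs \<Gamma> \<union> fvs \<Delta> \<union> fv (All v \<phi>) \<Longrightarrow>
    inference K I [\<Gamma> \<Turnstile> finsert (subst \<phi> v (V u)) \<Delta>] (\<Gamma> \<Turnstile> finsert (All v \<phi>) \<Delta>)"
| NegL: "inference K I [\<Gamma> \<Turnstile> finsert \<phi> \<Delta>] (finsert (Neg \<phi>) \<Gamma> \<Turnstile> \<Delta>)"
| NegR: "inference K I [finsert \<phi> \<Gamma> \<Turnstile> \<Delta>] (\<Gamma> \<Turnstile> finsert (Neg \<phi>) \<Delta>)"
| Ref: "inference K I [finsert (Eq t t) \<Gamma> \<Turnstile> \<Delta>] (\<Gamma> \<Turnstile> \<Delta>)"
| RepL: "literal \<phi> \<Longrightarrow>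
    inference K I [finsert (subst \<phi> v t) \<Gamma> \<Turnstile> \<Delta>] ({|Eq s t, subst \<phi> v s|} |\<union>| \<Gamma> \<Turnstile> \<Delta>)"
  \<comment> \<open>arithmetic and induction\<close>
| PA: "pa_axiom \<phi> \<Longrightarrow> inference K I [] ({||} \<Turnstile> {|\<phi>|})"
| IND: "I = Full \<or> I = Restricted \<and> arithmetical \<phi> \<Longrightarrow>
    free_for (V u) v \<phi> \<Longrightarrow> free_for (Sc (V u)) v \<phi> \<Longrightarrow> free_for t v \<phi> \<Longrightarrow>
    u \<notin> fvs \<Gamma> \<union> fvs \<Delta> \<union> fv (subst \<phi> v Zero) \<Longrightarrow>
    inference K I [finsert (subst \<phi> v (V u)) \<Gamma> \<Turnstile> finsert (subst \<phi> v (Sc (V u))) \<Delta>]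
      (finsert (subst \<phi> v Zero) \<Gamma> \<Turnstile> finsert (subst \<phi> v t) \<Delta>)"
| INDint: "I = Internal \<Longrightarrow> u \<notin> fvs \<Gamma> \<union> fvs \<Delta> \<union> tv x \<union> tv v \<Longrightarrow>
    inference K I
      [{|Fml1 x, Tr (Sub x (num (V u)) v)|} |\<union>| \<Gamma> \<Turnstile> finsert (Tr (Sub x (num (Sc (V u))) v)) \<Delta>]
      (finsert (Tr (Sub x (num Zero) v)) \<Gamma> \<Turnstile> finsert (Tr (Sub x (num z) v)) \<Delta>)"
  \<comment> \<open>truth axioms\<close>
| TEq1: "inference K I []
    ({|ClTerm x, ClTerm y, eq_val x y|} |\<union>| \<Gamma> \<Turnstile> finsert (Tr (deq x y)) \<Delta>)"
| TEq2: "inference K I []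
    ({|ClTerm x, ClTerm y, Tr (deq x y)|} |\<union>| \<Gamma> \<Turnstile> finsert (eq_val x y) \<Delta>)"
| TNeq1: "inference K I []
    ({|ClTerm x, ClTerm y, Neg (eq_val x y)|} |\<union>| \<Gamma> \<Turnstile> finsert (Tr (dneg (deq x y))) \<Delta>)"
| TNeq2: "inference K I []
    ({|ClTerm x, ClTerm y, Tr (dneg (deq x y))|} |\<union>| \<Gamma> \<Turnstile> finsert (Neg (eq_val x y)) \<Delta>)"
| TSent: "inference K I [] (finsert (Tr x) \<Gamma> \<Turnstile> finsert (Sent x) \<Delta>)"
| Reg1: "inference K I []
    ({|IsVar z, ClTerm y, Sent (dall z x), Tr (Sub x y z)|} |\<union>| \<Gamma>
      \<Turnstile> finsert (with_val y [x, z] (\<lambda>a. Tr (Sub x (num a) z))) \<Delta>)"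
| Reg2: "inference K I []
    ({|IsVar z, ClTerm y, Sent (dall z x), with_val y [x, z] (\<lambda>a. Tr (Sub x (num a) z))|} |\<union>| \<Gamma>
      \<Turnstile> finsert (Tr (Sub x y z)) \<Delta>)"
  \<comment> \<open>truth rules\<close>
| TTL: "inference K I
    [{|ClTerm x, with_val x [] (\<lambda>a. Tr a)|} |\<union>| \<Gamma> \<Turnstile> \<Delta>]
    ({|ClTerm x, Tr (dtr x)|} |\<union>| \<Gamma> \<Turnstile> \<Delta>)"
| TTR: "inference K I
    [finsert (ClTerm x) \<Gamma> \<Turnstile> finsert (with_val x [] (\<lambda>a. Tr a)) \<Delta>]
    (finsert (ClTerm x) \<Gamma> \<Turnstile> finsert (Tr (dtr x)) \<Delta>)"
| TNegTL: "inference K I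
    [{|ClTerm x, with_val x [] (\<lambda>a. Tr (dneg a))|} |\<union>| \<Gamma> \<Turnstile> \<Delta>,
     {|ClTerm x, Neg (with_val x [] (\<lambda>a. Sent a))|} |\<union>| \<Gamma> \<Turnstile> \<Delta>]
    ({|ClTerm x, Tr (dneg (dtr x))|} |\<union>| \<Gamma> \<Turnstile> \<Delta>)"
| TNegTR: "inference K I
    [finsert (ClTerm x) \<Gamma> \<Turnstile>
      {|with_val x [] (\<lambda>a. Tr (dneg a)), Neg (with_val x [] (\<lambda>a. Sent a))|} |\<union>| \<Delta>]
    (finsert (ClTerm x) \<Gamma> \<Turnstile> finsert (Tr (dneg (dtr x))) \<Delta>)"
| TNegNegL: "inference K I
    [{|Sent x, Tr x|} |\<union>| \<Gamma> \<Turnstile> \<Delta>]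
    ({|Sent x, Tr (dneg (dneg x))|} |\<union>| \<Gamma> \<Turnstile> \<Delta>)"
| TNegNegR: "inference K I
    [finsert (Sent x) \<Gamma> \<Turnstile> finsert (Tr x) \<Delta>]
    (finsert (Sent x) \<Gamma> \<Turnstile> finsert (Tr (dneg (dneg x))) \<Delta>)"
| TAndL: "inference K I
    [{|Sent (dand x y), Tr x, Tr y|} |\<union>| \<Gamma> \<Turnstile> \<Delta>]
    ({|Sent (dand x y), Tr (dand x y)|} |\<union>| \<Gamma> \<Turnstile> \<Delta>)"
| TAndR: "inference K I
    [finsert (Sent (dand x y)) \<Gamma> \<Turnstile> finsert (Tr x) \<Delta>,
     finsert (Sent (dand x y)) \<Gamma> \<Turnstile> finsert (Tr y) \<Delta>]
    (finsert (Sent (dand x y)) \<Gamma> \<Turnstile> finsert (Tr (dand x y)) \<Delta>)"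
| TNegAndL: "inference K I
    [{|Sent (dand x y), Tr (dneg x)|} |\<union>| \<Gamma> \<Turnstile> \<Delta>,
     {|Sent (dand x y), Tr (dneg y)|} |\<union>| \<Gamma> \<Turnstile> \<Delta>]
    ({|Sent (dand x y), Tr (dneg (dand x y))|} |\<union>| \<Gamma> \<Turnstile> \<Delta>)"
| TNegAndR: "inference K I
    [finsert (Sent (dand x y)) \<Gamma> \<Turnstile> {|Tr (dneg x), Tr (dneg y)|} |\<union>| \<Delta>]
    (finsert (Sent (dand x y)) \<Gamma> \<Turnstile> finsert (Tr (dneg (dand x y))) \<Delta>)"
| TAllL: "i \<notin> tv x \<union> tv v \<Longrightarrow> inference K I
    [{|Sent (dall v x), All i (Tr (Sub x (num (V i)) v))|} |\<union>| \<Gamma> \<Turnstile> \<Delta>]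
    ({|Sent (dall v x), Tr (dall v x)|} |\<union>| \<Gamma> \<Turnstile> \<Delta>)"
| TAllR: "i \<notin> tv x \<union> tv v \<Longrightarrow> inference K I
    [finsert (Sent (dall v x)) \<Gamma> \<Turnstile> finsert (All i (Tr (Sub x (num (V i)) v))) \<Delta>]
    (finsert (Sent (dall v x)) \<Gamma> \<Turnstile> finsert (Tr (dall v x)) \<Delta>)"
| TNegAllL: "i \<notin> tv x \<union> tv v \<Longrightarrow> inference K I
    [{|Sent (dall v x), Neg (All i (Neg (Tr (dneg (Sub x (num (V i)) v)))))|} |\<union>| \<Gamma> \<Turnstile> \<Delta>]
    ({|Sent (dall v x), Tr (dneg (dall v x))|} |\<union>| \<Gamma> \<Turnstile> \<Delta>)"
| TNegAllR: "i \<notin> tv x \<union> tv v \<Longrightarrow> inference K I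
    [finsert (Sent (dall v x)) \<Gamma> \<Turnstile>
      finsert (Neg (All i (Neg (Tr (dneg (Sub x (num (V i)) v)))))) \<Delta>]
    (finsert (Sent (dall v x)) \<Gamma> \<Turnstile> finsert (Tr (dneg (dall v x))) \<Delta>)"
  \<comment> \<open>consistency, completeness, symmetry\<close>
| Csis: "K = KFcs \<Longrightarrow> inference K I []
    ({|Sent x, Tr (dneg x)|} |\<union>| \<Gamma> \<Turnstile> finsert (Neg (Tr x)) \<Delta>)"
| Cmpl: "K = KFcp \<Longrightarrow> inference K I []
    ({|Sent x, Neg (Tr x)|} |\<union>| \<Gamma> \<Turnstile> finsert (Tr (dneg x)) \<Delta>)"
| Symm: "K = KFS \<Longrightarrow> inference K I []
    ({|Sent x, Sent y, Tr x, Tr (dneg x)|} |\<union>| \<Gamma> \<Turnstile> {|Tr y, Tr (dneg y)|} |\<union>| \<Delta>)"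

datatype 'a dtree = Nd (label: 'a) (subtrees: "'a dtree list")

primrec is_derivation :: "truth_theory \<Rightarrow> induction_version \<Rightarrow> sequent dtree \<Rightarrow> bool" where
  "is_derivation K I (Nd S Ds) \<longleftrightarrow>
     inference K I (map label Ds) S \<and> (\<forall>b\<in>set (map (is_derivation K I) Ds). b)"

definition derivable :: "truth_theory \<Rightarrow> induction_version \<Rightarrow> sequent \<Rightarrow> bool" where
  "derivable K I S \<longleftrightarrow> (\<exists>D. is_derivation K I D \<and> label D = S)"


section \<open>Significant inferences\<close>

definition T_quote :: "fm fset \<Rightarrow> fm fset" where
  "T_quote \<Gamma> = (\<lambda>\<gamma>. Tr (quote_fm \<gamma>)) |`| \<Gamma>"

text \<open>The term for the result of formally substituting, for each free variable of \<open>\<phi>\<close>, the numeral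
  of the value of that variable.  It is \<open>quote_fm \<phi>\<close> if \<open>\<phi>\<close> is a sentence.\<close>

definition quote_dot :: "fm \<Rightarrow> tm" where
  "quote_dot \<phi> = fold (\<lambda>i s. Sub s (num (V i)) (quote_tm (V i)))
                      (sorted_list_of_set (fv \<phi>)) (quote_fm \<phi>)"

definition T_quote_dot :: "fm fset \<Rightarrow> fm fset" where
  "T_quote_dot \<Gamma> = (\<lambda>\<gamma>. Tr (quote_dot \<gamma>)) |`| \<Gamma>"

definition SI :: "truth_theory \<Rightarrow> induction_version \<Rightarrow> (fm fset \<times> fm fset) set" where
  "SI K I = {(\<Gamma>, \<Delta>). (\<forall>\<gamma>\<in>fset (\<Gamma> |\<union>| \<Delta>). sentence \<gamma>) \<and>
                      derivable K I (T_quote \<Gamma> \<Turnstile> T_quote \<Delta>)}"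

fun sequent_in_SI :: "truth_theory \<Rightarrow> induction_version \<Rightarrow> sequent \<Rightarrow> bool" where
  "sequent_in_SI K I (\<Gamma> \<Turnstile> \<Delta>) \<longleftrightarrow> derivable K I (T_quote_dot \<Gamma> \<Turnstile> T_quote_dot \<Delta>)"

lemma quote_dot_sentence: "sentence \<phi> \<Longrightarrow> quote_dot \<phi> = quote_fm \<phi>"
  by (simp add: quote_dot_def sentence_def)

lemma sequent_in_SI_sentences:
  assumes "\<forall>\<gamma>\<in>fset (\<Gamma> |\<union>| \<Delta>). sentence \<gamma>"
  shows "sequent_in_SI K I (\<Gamma> \<Turnstile> \<Delta>) \<longleftrightarrow> (\<Gamma>, \<Delta>) \<in> SI K I"
proof -
  have "T_quote_dot \<Gamma> = T_quote \<Gamma>" "T_quote_dot \<Delta> = T_quote \<Delta>"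
    unfolding T_quote_dot_def T_quote_def
    using assms by (auto intro!: fset.map_cong simp: quote_dot_sentence)
  then show ?thesis using assms by (simp add: SI_def)
qed

end

theory Submission
  imports Defs "HOL-Library.Countable_Set"
begin

text \<open>
  Add \<open>T\<Gamma>\<close> to the antecedent and \<open>T\<Delta>\<close> to the succedent of every node of the given derivation.
  These formulae are closed, so all rules remain correct, and every new node \<open>\<Gamma>' \<Turnstile> \<Delta>'\<close> is a
  significant inference: the quotation of \<open>T\<Gamma>\<close> is among the formulae of \<open>T\<Gamma>'\<close>, likewise for
  \<open>T\<Delta>\<close>, and \<open>T(T\<gamma>)\<close> is provably equivalent to \<open>T\<gamma>\<close>.  Only the axioms of arithmetic have no side
  formulae.  They enter by a cut, so they have to be significant themselves; this is disquotation for
  arithmetical formulae.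

  Provability in the calculus is obtained from a completeness theorem: disquotation is verified in
  an arbitrary, possibly nonstandard, model, with induction over the model for definable properties
  and induction over standard terms and formulae outside.
\<close>

section \<open>Derivations\<close>

text \<open>Significance of an open node concerns the quotations of all its formulae with numerals
  inserted. Nothing has to be known about most of them: elementwise quotation is monotone, so the
  sequent needed for a new node arises by weakening from the one for the added closed formulae.
  Weakening is not among the rules and has to be obtained from cut. Disquotation is confined to
  arithmetical formulae because \<open>T\<close> of a negated \<open>T\<close>-atom does not express
  the classical negation of that atom: it means that the negation of the quoted object is true or
  that the object is no sentence. This suffices, since stronger forms of induction are rules with
  side formulae and the axioms proper are arithmetical. A model is by definition a structure
  satisfying every derivable sequent. Soundness of the single rules is thus never at issue, and the
  twelve theories are treated uniformly: inside a model only arithmetical induction is invoked.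
  Quantifiers range over nonstandard elements too, so instances of a standard formula involve
  numerals of nonstandard length; facts about these numerals need induction inside the
  model.\<close>

inductive der :: "truth_theory \<Rightarrow> induction_version \<Rightarrow> (sequent \<Rightarrow> bool) \<Rightarrow> sequent \<Rightarrow> bool"
  for K I Q where
  der_step: "inference K I Ps S \<Longrightarrow> (\<And>P. P \<in> set Ps \<Longrightarrow> der K I Q P) \<Longrightarrow> Q S \<Longrightarrow> der K I Q S"

text \<open>Trees are traded for an inductive predicate in order to have rule induction, with
  \<open>Q\<close> imposed on every node. Collecting a tree for each premise needs a choice.\<close>

lemma der_iff_derivation:
  "der K I Q S \<longleftrightarrow> (\<exists>D. is_derivation K I D \<and> label D = S \<and> (\<forall>d\<in>set_dtree D. Q d))"
proof
  assume "der K I Q S"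
  then show "\<exists>D. is_derivation K I D \<and> label D = S \<and> (\<forall>d\<in>set_dtree D. Q d)"
  proof induction
    case (der_step Ps S)
    then obtain f where f: "\<And>P. P \<in> set Ps \<Longrightarrow>
        is_derivation K I (f P) \<and> label (f P) = P \<and> (\<forall>d\<in>set_dtree (f P). Q d)"
      by metis
    have "map label (map f Ps) = Ps" using f by (simp add: map_idI)
    then have "is_derivation K I (Nd S (map f Ps))" using f der_step.hyps by (auto simp del: map_map)
    moreover have "\<forall>d\<in>set_dtree (Nd S (map f Ps)). Q d" using f der_step.hyps by auto
    ultimately show ?case by (intro exI[of _ "Nd S (map f Ps)"]) auto
  qed
next
  assume "\<exists>D. is_derivation K I D \<and> label D = S \<and> (\<forall>d\<in>set_dtree D. Q d)"
  then obtain D where "is_derivation K I D" "label D = S" "\<forall>d\<in>set_dtree D. Q d" by blast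
  then show "der K I Q S"
  proof (induction D arbitrary: S)
    case (Nd S' Ds)
    show ?case
    proof (rule der_step[of K I "map label Ds"])
      show "der K I Q P" if "P \<in> set (map label Ds)" for P
        using that Nd by auto
    qed (use Nd.prems in auto)
  qed
qed

lemma derivable_iff_der: "derivable K I S \<longleftrightarrow> der K I (\<lambda>_. True) S"
  by (auto simp: derivable_def der_iff_derivation)

lemma derivable_step: "inference K I Ps S \<Longrightarrow> \<forall>P\<in>set Ps. derivable K I P \<Longrightarrow> derivable K I S"
  unfolding derivable_iff_der by (rule der_step) auto

section \<open>Fresh variables, identity sequents and weakening\<close>

fun max_tm :: "tm \<Rightarrow> nat" where
  "max_tm (V i) = Suc i"
| "max_tm Zero = 0"
| "max_tm (F1 f t) = max_tm t"
| "max_tm (F2 f s t) = max (max_tm s) (max_tm t)"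

text \<open>Bound variables count as well.\<close>

fun max_fm :: "fm \<Rightarrow> nat" where
  "max_fm (Eq s t) = max (max_tm s) (max_tm t)"
| "max_fm (Tr t) = max_tm t"
| "max_fm (Neg \<phi>) = max_fm \<phi>"
| "max_fm (And \<phi> \<psi>) = max (max_fm \<phi>) (max_fm \<psi>)"
| "max_fm (All i \<phi>) = max (Suc i) (max_fm \<phi>)"

text \<open>Terms count nothing: an instance of a quantified formula is not a subformula, but it has
  the complexity of the matrix.\<close>

fun complexity :: "fm \<Rightarrow> nat" where
  "complexity (Eq s t) = 0"
| "complexity (Tr t) = 0"
| "complexity (Neg \<phi>) = Suc (complexity \<phi>)"
| "complexity (And \<phi> \<psi>) = Suc (complexity \<phi> + complexity \<psi>)"
| "complexity (All i \<phi>) = Suc (complexity \<phi>)"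

lemma complexity_subst [simp]: "complexity (subst \<phi> v t) = complexity \<phi>"
  by (induction \<phi>) auto

lemma tv_max: "i \<in> tv t \<Longrightarrow> i < max_tm t"
  by (induction t) auto

lemma fv_max: "i \<in> fv \<phi> \<Longrightarrow> i < max_fm \<phi>"
  by (induction \<phi>) (auto dest: tv_max)

lemma free_for_fresh: "max_fm \<phi> \<le> u \<Longrightarrow> free_for (V u) v \<phi>"
  by (induction \<phi>) auto

lemma finite_tv [simp]: "finite (tv t)"
  by (induction t) auto

lemma finite_fv [simp]: "finite (fv \<phi>)"
  by (induction \<phi>) auto

lemma ex_fresh: "\<exists>u\<ge>n. \<forall>\<phi>\<in>fset \<Gamma>. max_fm \<phi> \<le> u"
proof -
  have "finite (max_fm ` fset \<Gamma>)" by simp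
  then have "\<forall>\<phi>\<in>fset \<Gamma>. max_fm \<phi> \<le> Max (insert n (max_fm ` fset \<Gamma>))" by simp
  moreover have "n \<le> Max (insert n (max_fm ` fset \<Gamma>))" by simp
  ultimately show ?thesis by blast
qed

lemma fresh_fvs: "\<forall>\<phi>\<in>fset \<Gamma>. max_fm \<phi> \<le> u \<Longrightarrow> u \<notin> fvs \<Gamma>"
  by (fastforce simp: fvs_def dest: fv_max)

text \<open>Initial sequents cover literals only, so \<phi> is decomposed on both sides at once.
  Every node of the resulting derivation extends \<Gamma> and \<Delta>, which is why
  \<open>Q\<close> is required of all larger sequents.\<close>

lemma der_identity:
  assumes "\<And>\<Gamma>' \<Delta>'. \<Gamma> |\<subseteq>| \<Gamma>' \<Longrightarrow> \<Delta> |\<subseteq>| \<Delta>' \<Longrightarrow> Q (\<Gamma>' \<Turnstile> \<Delta>')"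
  shows "der K I Q (finsert \<phi> \<Gamma> \<Turnstile> finsert \<phi> \<Delta>)"
  using assms
proof (induction "complexity \<phi>" arbitrary: \<phi> \<Gamma> \<Delta> rule: less_induct)
  case less
  have Q: "Q (\<Gamma>' \<Turnstile> \<Delta>')" if "\<Gamma> |\<subseteq>| \<Gamma>'" "\<Delta> |\<subseteq>| \<Delta>'" for \<Gamma>' \<Delta>'
    using less.prems that by blast
  have IH: "der K I Q (finsert \<psi> \<Gamma>' \<Turnstile> finsert \<psi> \<Delta>')"
    if "complexity \<psi> < complexity \<phi>" "\<Gamma> |\<subseteq>| \<Gamma>'" "\<Delta> |\<subseteq>| \<Delta>'" for \<psi> \<Gamma>' \<Delta>'
    using that by (intro less.hyps Q) auto
  show ?case
  proof (cases \<phi>)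
    case (Neg \<psi>)
    have "der K I Q (finsert \<psi> \<Gamma> \<Turnstile> finsert \<psi> \<Delta>)" using Neg by (intro IH) auto
    then have "der K I Q (finsert (Neg \<psi>) (finsert \<psi> \<Gamma>) \<Turnstile> \<Delta>)"
      by (intro der_step[OF NegL]) (auto intro: Q)
    then show ?thesis unfolding Neg
      by (intro der_step[OF NegR]) (auto intro: Q simp: finsert_commute)
  next
    case (And \<psi> \<chi>)
    have "der K I Q (finsert \<psi> (finsert \<chi> \<Gamma>) \<Turnstile> finsert \<psi> \<Delta>)"
      "der K I Q (finsert \<chi> (finsert \<psi> \<Gamma>) \<Turnstile> finsert \<chi> \<Delta>)"
      using And by (auto intro!: IH)
    then have "der K I Q (finsert (And \<psi> \<chi>) \<Gamma> \<Turnstile> finsert \<psi> \<Delta>)"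
      "der K I Q (finsert (And \<psi> \<chi>) \<Gamma> \<Turnstile> finsert \<chi> \<Delta>)"
      by (auto intro!: der_step[OF AndL] Q simp: finsert_commute)
    then show ?thesis unfolding And
      by (intro der_step[OF AndR]) (auto intro: Q)
  next
    case (All v \<psi>)
    \<comment> \<open>Lying above all indices, bound ones included, \<open>u\<close> is fit as an
      eigenvariable and cannot be captured.\<close>
    obtain u where u: "\<forall>\<chi>\<in>fset (finsert \<phi> (\<Gamma> |\<union>| \<Delta>)). max_fm \<chi> \<le> u" using ex_fresh by blast
    then have ff: "free_for (V u) v \<psi>" using All by (auto intro: free_for_fresh)
    have "u \<notin> fvs (finsert \<phi> (\<Gamma> |\<union>| \<Delta>))" using u by (rule fresh_fvs)
    then have fr: "u \<notin> fvs (finsert \<phi> \<Gamma>) \<union> fvs \<Delta> \<union> fv (All v \<psi>)"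
      using All by (auto simp: fvs_def)
    have "der K I Q (finsert (subst \<psi> v (V u)) \<Gamma> \<Turnstile> finsert (subst \<psi> v (V u)) \<Delta>)"
      using All by (intro IH) auto
    then have "der K I Q (finsert (All v \<psi>) \<Gamma> \<Turnstile> finsert (subst \<psi> v (V u)) \<Delta>)"
      by (intro der_step[OF AllL[OF ff]]) (auto intro: Q)
    then show ?thesis using fr unfolding All
      by (intro der_step[OF AllR[OF ff]]) (auto intro: Q)
  qed (auto intro!: der_step[OF Init] Q simp: literal_def atomic_def)
qed

lemma derivable_identity: "\<phi> |\<in>| \<Gamma> \<Longrightarrow> \<phi> |\<in>| \<Delta> \<Longrightarrow> derivable K I (\<Gamma> \<Turnstile> \<Delta>)"
  using der_identity[of \<Gamma> \<Delta> "\<lambda>_. True" K I \<phi>]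
  by (simp add: derivable_iff_der finsert_absorb)

lemma derivable_cut:
  assumes "derivable K I (\<Gamma> \<Turnstile> finsert \<phi> \<Delta>)" "derivable K I (finsert \<phi> \<Gamma>' \<Turnstile> \<Delta>')"
  shows "derivable K I (\<Gamma>' |\<union>| \<Gamma> \<Turnstile> \<Delta> |\<union>| \<Delta>')"
  using assms by (intro derivable_step[OF Cut]) auto

text \<open>Cutting with an identity sequent adds arbitrary side formulae without renaming any
  eigenvariable; it only needs some formula to cut on.\<close>

lemma derivable_weaken_nonempty:
  assumes der: "derivable K I (\<Gamma> \<Turnstile> \<Delta>)" and sub: "\<Gamma> |\<subseteq>| \<Gamma>'" "\<Delta> |\<subseteq>| \<Delta>'"
    and ne: "\<Gamma> \<noteq> {||} \<or> \<Delta> \<noteq> {||}"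
  shows "derivable K I (\<Gamma>' \<Turnstile> \<Delta>')"
proof (cases "\<Delta> = {||}")
  case False
  then obtain \<phi> where \<phi>: "\<phi> |\<in>| \<Delta>" by auto
  have "derivable K I (\<Gamma>' |\<union>| \<Gamma> \<Turnstile> \<Delta> |\<union>| \<Delta>')"
    by (rule derivable_cut[of _ _ _ \<phi>])
      (use der \<phi> sub in \<open>auto simp: finsert_absorb intro: derivable_identity\<close>)
  then show ?thesis using sub by (simp add: sup.absorb1 sup.absorb2)
next
  case True
  then obtain \<phi> where \<phi>: "\<phi> |\<in>| \<Gamma>" using ne by auto
  have "derivable K I (\<Gamma> |\<union>| \<Gamma>' \<Turnstile> \<Delta>' |\<union>| \<Delta>)"
    by (rule derivable_cut[of _ _ _ \<phi>])
      (use der \<phi> sub in \<open>auto simp: finsert_absorb intro: derivable_identity\<close>)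
  then show ?thesis using sub by (simp add: sup.absorb1 sup.absorb2)
qed

text \<open>All rules except \<open>Ref\<close> and \<open>Cut\<close> display a formula in their
  conclusion.\<close>

lemma inference_empty_cases:
  assumes "inference K I Ps ({||} \<Turnstile> {||})"
  obtains t where "Ps = [{|Eq t t|} \<Turnstile> {||}]"
  | \<phi> where "Ps = [{||} \<Turnstile> {|\<phi>|}, {|\<phi>|} \<Turnstile> {||}]"
  using assms by (cases rule: inference.cases) (simp_all add: fempty_not_finsert)

text \<open>The empty sequent offers no formula to cut on. The premises of its last inference do;
  they are weakened first and the inference is repeated.\<close>

lemma derivable_weaken:
  assumes der: "derivable K I (\<Gamma> \<Turnstile> \<Delta>)" and sub: "\<Gamma> |\<subseteq>| \<Gamma>'" "\<Delta> |\<subseteq>| \<Delta>'"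
  shows "derivable K I (\<Gamma>' \<Turnstile> \<Delta>')"
proof (cases "\<Gamma> = {||} \<and> \<Delta> = {||}")
  case False
  then show ?thesis using derivable_weaken_nonempty[OF assms] by blast
next
  case True
  then have "der K I (\<lambda>_. True) ({||} \<Turnstile> {||})" using der by (simp add: derivable_iff_der)
  then obtain Ps where inf: "inference K I Ps ({||} \<Turnstile> {||})"
    and Ps: "\<And>P. P \<in> set Ps \<Longrightarrow> derivable K I P"
    by (cases rule: der.cases) (auto simp: derivable_iff_der)
  from inf show ?thesis
  proof (cases rule: inference_empty_cases)
    case (1 t)
    have "derivable K I (finsert (Eq t t) \<Gamma>' \<Turnstile> \<Delta>')"
      by (rule derivable_weaken_nonempty[of K I "{|Eq t t|}" "{||}"]) (use Ps 1 in auto)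
    then show ?thesis by (intro derivable_step[OF inference.Ref]) auto
  next
    case (2 \<phi>)
    have "derivable K I (\<Gamma>' \<Turnstile> finsert \<phi> \<Delta>')"
      by (rule derivable_weaken_nonempty[of K I "{||}" "{|\<phi>|}"]) (use Ps 2 in auto)
    moreover have "derivable K I (finsert \<phi> \<Gamma>' \<Turnstile> \<Delta>')"
      by (rule derivable_weaken_nonempty[of K I "{|\<phi>|}" "{||}"]) (use Ps 2 in auto)
    ultimately show ?thesis using derivable_cut[of K I \<Gamma>' \<phi> \<Delta>' \<Gamma>' \<Delta>'] by simp
  qed
qed

lemma derivable_cut_same:
  assumes "derivable K I (\<Gamma> \<Turnstile> finsert \<phi> \<Delta>)" "derivable K I (finsert \<phi> \<Gamma> \<Turnstile> \<Delta>)"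
  shows "derivable K I (\<Gamma> \<Turnstile> \<Delta>)"
  using derivable_cut[OF assms] by simp

section \<open>Adding closed side formulae\<close>

definition weaken :: "fm fset \<Rightarrow> fm fset \<Rightarrow> sequent \<Rightarrow> sequent" where
  "weaken \<Gamma>' \<Delta>' S = (case S of \<Gamma> \<Turnstile> \<Delta> \<Rightarrow> (\<Gamma> |\<union>| \<Gamma>' \<Turnstile> \<Delta> |\<union>| \<Delta>'))"

lemma weaken_simps [simp]: "weaken \<Gamma>' \<Delta>' (\<Gamma> \<Turnstile> \<Delta>) = (\<Gamma> |\<union>| \<Gamma>' \<Turnstile> \<Delta> |\<union>| \<Delta>')"
  by (simp add: weaken_def)

lemma fvs_simps [simp]: "fvs (\<Gamma> |\<union>| \<Delta>) = fvs \<Gamma> \<union> fvs \<Delta>" "fvs (finsert \<phi> \<Gamma>) = fv \<phi> \<union> fvs \<Gamma>" "fvs {||} = {}"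
  by (auto simp: fvs_def)

text \<open>The initial sequents for arithmetic are the only ones without side formulae.\<close>

lemma inference_weaken:
  assumes "inference K I Ps S" "fvs C = {}" "fvs D = {}"
  shows "inference K I (map (weaken C D) Ps) (weaken C D S) \<or> (\<exists>\<phi>. pa_axiom \<phi> \<and> S = ({||} \<Turnstile> {|\<phi>|}))"
  using assms(1)
proof cases
  case (Cut \<Gamma> \<phi> \<Delta> \<Gamma>' \<Delta>')
  \<comment> \<open>Both contexts of the cut receive \<open>C\<close> and \<open>D\<close>; the
    union in the conclusion absorbs the second copy.\<close>
  have *: "\<Gamma>' |\<union>| \<Gamma> |\<union>| C = (\<Gamma>' |\<union>| C) |\<union>| (\<Gamma> |\<union>| C)"
    "\<Delta> |\<union>| \<Delta>' |\<union>| D = (\<Delta> |\<union>| D) |\<union>| (\<Delta>' |\<union>| D)" by auto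
  show ?thesis unfolding Cut list.map weaken_simps funion_finsert_left * by (intro disjI1 inference.Cut)
next
  case (PA \<phi>)
  then show ?thesis by blast
\<comment> \<open>The other rules have arbitrary contexts, and closed side formulae leave every
  eigenvariable condition intact.\<close>
qed (insert assms(2,3), (simp only: list.map weaken_simps funion_finsert_left sup_bot_left,
    intro disjI1, (rule inference.intros[unfolded funion_finsert_left sup_bot_left];
      (assumption | simp)))+)

section \<open>Structures and completeness\<close>

record 'a interp =
  zero :: 'a
  fun1 :: "fn1 \<Rightarrow> 'a \<Rightarrow> 'a"
  fun2 :: "fn2 \<Rightarrow> 'a \<Rightarrow> 'a \<Rightarrow> 'a"
  truth :: "'a set"

primrec ev :: "'a interp \<Rightarrow> (nat \<Rightarrow> 'a) \<Rightarrow> tm \<Rightarrow> 'a" where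
  "ev M e (V i) = e i"
| "ev M e Zero = zero M"
| "ev M e (F1 f t) = fun1 M f (ev M e t)"
| "ev M e (F2 f s t) = fun2 M f (ev M e s) (ev M e t)"

primrec sat :: "'a interp \<Rightarrow> (nat \<Rightarrow> 'a) \<Rightarrow> fm \<Rightarrow> bool" where
  "sat M e (Eq s t) \<longleftrightarrow> ev M e s = ev M e t"
| "sat M e (Tr t) \<longleftrightarrow> ev M e t \<in> truth M"
| "sat M e (Neg \<phi>) \<longleftrightarrow> \<not> sat M e \<phi>"
| "sat M e (And \<phi> \<psi>) \<longleftrightarrow> sat M e \<phi> \<and> sat M e \<psi>"
| "sat M e (All i \<phi>) \<longleftrightarrow> (\<forall>d. sat M (e(i := d)) \<phi>)"

lemma ev_cong: "(\<And>i. i \<in> tv t \<Longrightarrow> e i = e' i) \<Longrightarrow> ev M e t = ev M e' t"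
  by (induction t) auto

lemma sat_cong: "(\<And>i. i \<in> fv \<phi> \<Longrightarrow> e i = e' i) \<Longrightarrow> sat M e \<phi> = sat M e' \<phi>"
proof (induction \<phi> arbitrary: e e')
  case (Eq s t)
  then show ?case using ev_cong[of s e e' M] ev_cong[of t e e' M] by simp
next
  case (Tr t)
  then show ?case using ev_cong[of t e e' M] by simp
next
  case (And \<phi> \<psi>)
  have "sat M e \<phi> = sat M e' \<phi>" by (rule And.IH(1)) (simp add: And.prems)
  moreover have "sat M e \<psi> = sat M e' \<psi>" by (rule And.IH(2)) (simp add: And.prems)
  ultimately show ?case by simp
next
  case (Neg \<phi>)
  have "sat M e \<phi> = sat M e' \<phi>" by (rule Neg.IH) (simp add: Neg.prems)
  then show ?case by simp
next
  case (All i \<phi>)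
  have "sat M (e(i := d)) \<phi> = sat M (e'(i := d)) \<phi>" for d
    using All.prems by (intro All.IH) auto
  then show ?case by simp
qed

lemma tsubst_id [simp]: "v \<notin> tv s \<Longrightarrow> tsubst s v t = s"
  by (induction s) auto

lemma subst_id: "v \<notin> fv \<phi> \<Longrightarrow> subst \<phi> v t = \<phi>"
  by (induction \<phi>) auto

lemma tsubst_self [simp]: "tsubst s v (V v) = s"
  by (induction s) auto

lemma subst_self [simp]: "subst \<phi> v (V v) = \<phi>"
  by (induction \<phi>) auto

lemma free_for_self: "free_for (V v) v \<phi>"
  by (induction \<phi>) auto

lemma free_for_closed: "tv t = {} \<Longrightarrow> free_for t v \<phi>"
  by (induction \<phi>) auto

lemma ev_tsubst: "ev M e (tsubst s v t) = ev M (e(v := ev M e t)) s"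
  by (induction s) auto

lemma sat_subst: "free_for t v \<phi> \<Longrightarrow> sat M e (subst \<phi> v t) = sat M (e(v := ev M e t)) \<phi>"
proof (induction \<phi> arbitrary: e)
  case (All i \<phi>)
  show ?case
  proof (cases "i = v \<or> v \<notin> fv (All i \<phi>)")
    case True
    then have "subst (All i \<phi>) v t = All i \<phi>" by (auto simp: subst_id)
    moreover have "sat M (e(v := ev M e t)) (All i \<phi>) = sat M e (All i \<phi>)"
      using True by (intro sat_cong) auto
    ultimately show ?thesis by (simp only:)
  next
    case False
    then have "free_for t v \<phi>" "i \<notin> tv t" "i \<noteq> v" using All.prems by auto
    have ev: "ev M (e(i := d)) t = ev M e t" for d using \<open>i \<notin> tv t\<close> by (intro ev_cong) auto
    have "sat M (e(i := d)) (subst \<phi> v t) = sat M (e(v := ev M e t, i := d)) \<phi>" for d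
      unfolding All.IH[OF \<open>free_for t v \<phi>\<close>] ev fun_upd_twist[OF \<open>i \<noteq> v\<close>] ..
    then show ?thesis using \<open>i \<noteq> v\<close> by (simp only: subst.simps if_False sat.simps)
  qed
qed (auto simp: ev_tsubst)

fun sequent_sat :: "'a interp \<Rightarrow> (nat \<Rightarrow> 'a) \<Rightarrow> sequent \<Rightarrow> bool" where
  "sequent_sat M e (\<Gamma> \<Turnstile> \<Delta>) \<longleftrightarrow> ((\<forall>\<gamma>\<in>fset \<Gamma>. sat M e \<gamma>) \<longrightarrow> (\<exists>\<delta>\<in>fset \<Delta>. sat M e \<delta>))"

text \<open>Models are defined through derivability, so soundness holds by definition and only the
  existence of enough models has to be proved.\<close>

definition is_model :: "truth_theory \<Rightarrow> induction_version \<Rightarrow> 'a interp \<Rightarrow> bool" where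
  "is_model K I M \<longleftrightarrow> (\<forall>S e. derivable K I S \<longrightarrow> sequent_sat M e S)"

lemma sat_foldr_All:
  "sat M e (foldr All vs \<phi>) \<longleftrightarrow> (\<forall>e'. (\<forall>i. i \<notin> set vs \<longrightarrow> e' i = e i) \<longrightarrow> sat M e' \<phi>)"
proof (induction vs arbitrary: e)
  case Nil
  then show ?case by (auto simp: fun_eq_iff[symmetric] simp del: fun_eq_iff)
next
  case (Cons v vs)
  have "(\<exists>d. \<forall>i. i \<notin> set vs \<longrightarrow> e' i = (e(v := d)) i) \<longleftrightarrow> (\<forall>i. i \<notin> set (v # vs) \<longrightarrow> e' i = e i)" for e'
  proof
    assume "\<forall>i. i \<notin> set (v # vs) \<longrightarrow> e' i = e i"
    then show "\<exists>d. \<forall>i. i \<notin> set vs \<longrightarrow> e' i = (e(v := d)) i" by (intro exI[of _ "e' v"]) auto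
  qed auto
  then show ?case unfolding foldr.simps comp_apply sat.simps Cons.IH by blast
qed

lemma sat_univ_closure: "sat M e (univ_closure \<phi>) \<longleftrightarrow> (\<forall>e. sat M e \<phi>)"
proof
  assume l: "sat M e (univ_closure \<phi>)"
  show "\<forall>e. sat M e \<phi>"
  proof
    fix e'
    have "sat M (\<lambda>i. if i \<in> fv \<phi> then e' i else e i) \<phi>"
      using l by (simp add: univ_closure_def sat_foldr_All)
    then show "sat M e' \<phi>" by (subst sat_cong[of \<phi> e']) auto
  qed
qed (simp add: univ_closure_def sat_foldr_All)

text \<open>With empty contexts the quantified variable can serve as its own eigenvariable.\<close>

lemma derivable_closure:
  "derivable K I ({||} \<Turnstile> {|\<phi>|}) \<Longrightarrow> derivable K I ({||} \<Turnstile> {|foldr All vs \<phi>|})"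
  by (induction vs) (auto intro!: derivable_step[OF AllR[OF free_for_self, where \<Gamma>="{||}" and \<Delta>="{||}"]])

lemma derivable_conj:
  "derivable K I (fset_of_list \<phi>s |\<union>| \<Gamma> \<Turnstile> \<Delta>) \<Longrightarrow>
   derivable K I (finsert (foldr And \<phi>s (Eq Zero Zero)) \<Gamma> \<Turnstile> \<Delta>)"
proof (induction \<phi>s arbitrary: \<Gamma>)
  case Nil
  then show ?case by (auto elim: derivable_weaken)
next
  case (Cons \<phi> \<phi>s)
  have "derivable K I (fset_of_list \<phi>s |\<union>| finsert \<phi> \<Gamma> \<Turnstile> \<Delta>)" using Cons.prems by simp
  from Cons.IH[OF this] show ?case
    by (auto intro!: derivable_step[OF AndL] simp: finsert_commute)
qed

lemma derivable_negs:
  "derivable K I (\<Gamma> \<Turnstile> fset_of_list \<phi>s |\<union>| \<Delta>) \<Longrightarrow>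
   derivable K I (fset_of_list (map Neg \<phi>s) |\<union>| \<Gamma> \<Turnstile> \<Delta>)"
proof (induction \<phi>s arbitrary: \<Delta>)
  case (Cons \<phi> \<phi>s)
  have "derivable K I (\<Gamma> \<Turnstile> fset_of_list \<phi>s |\<union>| finsert \<phi> \<Delta>)" using Cons.prems by simp
  from Cons.IH[OF this] show ?case by (auto intro!: derivable_step[OF NegL])
qed simp

text \<open>The formula negates the conjunction of the antecedent with the negated succedent. Unlike
  a sequent, a single formula can be universally closed, which carries validity from one assignment
  to all.\<close>

lemma derivable_sequent_formula:
  assumes "derivable K I S"
  shows "\<exists>\<chi>. derivable K I ({||} \<Turnstile> {|\<chi>|}) \<and> (\<forall>(M :: 'a interp) e. sat M e \<chi> \<longleftrightarrow> sequent_sat M e S)"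
proof -
  obtain \<Gamma> \<Delta> where S: "S = (\<Gamma> \<Turnstile> \<Delta>)" by (cases S)
  obtain gs ds where gs: "fset_of_list gs = \<Gamma>" and ds: "fset_of_list ds = \<Delta>"
    using exists_fset_of_list by metis
  let ?c = "foldr And (map Neg ds @ gs) (Eq Zero Zero)"
  have "derivable K I (fset_of_list (map Neg ds) |\<union>| \<Gamma> \<Turnstile> {||})"
    using assms S ds by (intro derivable_negs) simp
  then have "derivable K I (fset_of_list (map Neg ds @ gs) |\<union>| {||} \<Turnstile> {||})" by (simp add: gs)
  then have "derivable K I ({|?c|} \<Turnstile> {||})" by (rule derivable_conj)
  then have d: "derivable K I ({||} \<Turnstile> {|Neg ?c|})" by (auto intro!: derivable_step[OF NegR])
  have conj: "sat M e (foldr And \<phi>s (Eq Zero Zero)) \<longleftrightarrow> (\<forall>\<phi>\<in>set \<phi>s. sat M e \<phi>)"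
    for M :: "'a interp" and e \<phi>s by (induction \<phi>s) auto
  have "fset \<Gamma> = set gs" "fset \<Delta> = set ds" using gs ds by (auto simp: fset_of_list.rep_eq)
  then have "sat M e (Neg ?c) \<longleftrightarrow> sequent_sat M e S" for M :: "'a interp" and e
    unfolding S sat.simps(3) conj sequent_sat.simps by (auto simp: ball_Un)
  with d show ?thesis by blast
qed

section \<open>Saturated sets of formulae\<close>

instance fn1 :: countable by countable_datatype
instance fn2 :: countable by countable_datatype
instance tm :: countable by countable_datatype
instance fm :: countable by countable_datatype

text \<open>\<open>L\<close> will be the set of formulae true in a term model. The bound
  \<open>m\<close> asks for witnessing variables of arbitrarily large index; later this allows every
  term to be named by a variable that no quantifier of a given formula captures.\<close>

definition saturated :: "truth_theory \<Rightarrow> induction_version \<Rightarrow> fm set \<Rightarrow> bool" where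
  "saturated K I L \<longleftrightarrow>
    (\<forall>\<Gamma> \<Delta>. fset \<Gamma> \<subseteq> L \<longrightarrow> fset \<Delta> \<inter> L = {} \<longrightarrow> \<not> derivable K I (\<Gamma> \<Turnstile> \<Delta>)) \<and>
    (\<forall>v \<psi> m. All v \<psi> \<notin> L \<longrightarrow> (\<exists>u\<ge>m. free_for (V u) v \<psi> \<and> subst \<psi> v (V u) \<notin> L))"

text \<open>If \<phi> could be added to neither side, cut would derive the given sequent. A
  universal formula that goes to the right is accompanied by an instance with a fresh variable, or
  else \<open>AllR\<close> would apply.\<close>

lemma saturation_step:
  assumes "\<not> derivable K I (\<Gamma> \<Turnstile> \<Delta>)"
  shows "\<exists>\<Gamma>' \<Delta>'. \<not> derivable K I (\<Gamma>' \<Turnstile> \<Delta>') \<and> \<Gamma> |\<subseteq>| \<Gamma>' \<and> \<Delta> |\<subseteq>| \<Delta>' \<and>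
    (\<phi> |\<in>| \<Gamma>' \<or> \<phi> |\<in>| \<Delta>' \<and>
      (\<forall>v \<psi>. \<phi> = All v \<psi> \<longrightarrow> (\<exists>u\<ge>m. free_for (V u) v \<psi> \<and> subst \<psi> v (V u) |\<in>| \<Delta>')))"
proof (cases "derivable K I (finsert \<phi> \<Gamma> \<Turnstile> \<Delta>)")
  case False
  then show ?thesis by (intro exI[of _ "finsert \<phi> \<Gamma>"] exI[of _ \<Delta>]) auto
next
  case True
  then have nd: "\<not> derivable K I (\<Gamma> \<Turnstile> finsert \<phi> \<Delta>)" using assms derivable_cut_same by blast
  show ?thesis
  proof (cases "\<exists>v \<psi>. \<phi> = All v \<psi>")
    case False
    with nd show ?thesis by (intro exI[of _ \<Gamma>] exI[of _ "finsert \<phi> \<Delta>"]) auto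
  next
    case True
    then obtain v \<psi> where \<phi>: "\<phi> = All v \<psi>" by blast
    obtain u where m: "u \<ge> m" and u: "\<forall>\<chi>\<in>fset (finsert \<phi> (\<Gamma> |\<union>| \<Delta>)). max_fm \<chi> \<le> u"
      using ex_fresh by blast
    then have ff: "free_for (V u) v \<psi>" using \<phi> by (auto intro: free_for_fresh)
    have fr: "u \<notin> fvs \<Gamma> \<union> fvs (finsert \<phi> \<Delta>) \<union> fv (All v \<psi>)"
      using fresh_fvs[OF u] \<phi> by auto
    have "\<not> derivable K I (\<Gamma> \<Turnstile> finsert (subst \<psi> v (V u)) (finsert \<phi> \<Delta>))"
    proof
      assume "derivable K I (\<Gamma> \<Turnstile> finsert (subst \<psi> v (V u)) (finsert \<phi> \<Delta>))"
      then have "derivable K I (\<Gamma> \<Turnstile> finsert (All v \<psi>) (finsert \<phi> \<Delta>))"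
        by (intro derivable_step[OF AllR[OF ff fr]]) auto
      then show False using nd \<phi> by simp
    qed
    then show ?thesis using m ff \<phi>
      by (intro exI[of _ \<Gamma>] exI[of _ "finsert (subst \<psi> v (V u)) (finsert \<phi> \<Delta>)"]) auto
  qed
qed

lemma ex_saturated:
  assumes "\<not> derivable K I (\<Gamma> \<Turnstile> \<Delta>)"
  obtains L where "saturated K I L" "fset \<Gamma> \<subseteq> L" "fset \<Delta> \<inter> L = {}"
proof -
  \<comment> \<open>The second component of the pair is idle, so every formula is treated at
    arbitrarily late stages. Since a witness chosen at stage \<open>n\<close> has index at least
    \<open>n\<close>, its index can be made as large as desired.\<close>
  define fml :: "nat \<Rightarrow> fm" where "fml n = from_nat (fst (prod_decode n))" for n
  define P where "P n p \<longleftrightarrow> \<not> derivable K I (fst p \<Turnstile> snd p) \<and> \<Gamma> |\<subseteq>| fst p \<and> \<Delta> |\<subseteq>| snd p"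
    for n :: nat and p
  define R where "R n p q \<longleftrightarrow> fst p |\<subseteq>| fst q \<and> snd p |\<subseteq>| snd q \<and>
    (fml n |\<in>| fst q \<or> fml n |\<in>| snd q \<and> (\<forall>v \<psi>. fml n = All v \<psi> \<longrightarrow>
      (\<exists>u\<ge>n. free_for (V u) v \<psi> \<and> subst \<psi> v (V u) |\<in>| snd q)))" for n :: nat and p q
  have base: "\<exists>p. P 0 p" using assms by (intro exI[of _ "(\<Gamma>, \<Delta>)"]) (simp add: P_def)
  have step: "\<exists>q. P (Suc n) q \<and> R n p q" if "P n p" for p n
  proof -
    have nd: "\<not> derivable K I (fst p \<Turnstile> snd p)" using that by (simp add: P_def)
    obtain \<Gamma>' \<Delta>' where "\<not> derivable K I (\<Gamma>' \<Turnstile> \<Delta>') \<and> fst p |\<subseteq>| \<Gamma>' \<and> snd p |\<subseteq>| \<Delta>' \<and>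
      (fml n |\<in>| \<Gamma>' \<or> fml n |\<in>| \<Delta>' \<and> (\<forall>v \<psi>. fml n = All v \<psi> \<longrightarrow>
        (\<exists>u\<ge>n. free_for (V u) v \<psi> \<and> subst \<psi> v (V u) |\<in>| \<Delta>')))"
      using saturation_step[OF nd, of "fml n" n] by (elim exE) (rule that)
    then show ?thesis using that unfolding P_def R_def
      by (intro exI[of _ "(\<Gamma>', \<Delta>')"]) auto
  qed
  obtain s where s: "\<And>n. P n (s n)" "\<And>n. R n (s n) (s (Suc n))"
    using dependent_nat_choice[of P R, OF base step] by metis
  define G D where "G n = fst (s n)" and "D n = snd (s n)" for n
  have nd: "\<not> derivable K I (G n \<Turnstile> D n)" for n using s(1) unfolding P_def G_def D_def by blast
  have "G n |\<subseteq>| G (Suc n)" "D n |\<subseteq>| D (Suc n)" for n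
    using s(2)[of n] by (simp_all add: R_def G_def D_def)
  then have monoG: "m \<le> n \<Longrightarrow> G m |\<subseteq>| G n" and monoD: "m \<le> n \<Longrightarrow> D m |\<subseteq>| D n" for m n
    by - (rule lift_Suc_mono_le, assumption+)+
  define L where "L = (\<Union>n. fset (G n))"
  \<comment> \<open>A formula met on both sides would be on both sides at one common stage, making
    that stage an identity sequent.\<close>
  have disj: "\<phi> |\<notin>| D n" if "\<phi> \<in> L" for \<phi> n
  proof
    assume "\<phi> |\<in>| D n"
    obtain m where "\<phi> |\<in>| G m" using \<open>\<phi> \<in> L\<close> L_def by auto
    then have "\<phi> |\<in>| G (max m n)" "\<phi> |\<in>| D (max m n)"
      using \<open>\<phi> |\<in>| D n\<close> monoG[of m "max m n"] monoD[of n "max m n"] by auto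
    then show False using nd derivable_identity by blast
  qed
  have handled: "\<exists>n\<ge>m. fml n = \<phi>" for \<phi> m
    by (rule exI[of _ "prod_encode (to_nat \<phi>, m)"]) (simp add: fml_def le_prod_encode_2)
  have inD: "\<exists>n. \<phi> |\<in>| D n" if "\<phi> \<notin> L" for \<phi>
  proof -
    obtain n where "fml n = \<phi>" using handled by blast
    then show ?thesis using s(2)[of n] that unfolding R_def L_def G_def D_def by auto
  qed
  have subG: "\<exists>n. \<Gamma>' |\<subseteq>| G n" if "fset \<Gamma>' \<subseteq> L" for \<Gamma>'
    using that
  proof (induction \<Gamma>')
    case (insert \<phi> \<Gamma>')
    then obtain m n where "\<phi> |\<in>| G m" "\<Gamma>' |\<subseteq>| G n" by (auto simp: L_def)
    then show ?case using monoG[of m "max m n"] monoG[of n "max m n"]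
      by (intro exI[of _ "max m n"]) auto
  qed auto
  have subD: "\<exists>n. \<Delta>' |\<subseteq>| D n" if "fset \<Delta>' \<inter> L = {}" for \<Delta>'
    using that
  proof (induction \<Delta>')
    case (insert \<phi> \<Delta>')
    moreover from this obtain m where "\<phi> |\<in>| D m" using inD[of \<phi>] by auto
    ultimately obtain m n where "\<phi> |\<in>| D m" "\<Delta>' |\<subseteq>| D n" by auto
    then show ?case using monoD[of m "max m n"] monoD[of n "max m n"]
      by (intro exI[of _ "max m n"]) auto
  qed auto
  have cons: "\<not> derivable K I (\<Gamma>' \<Turnstile> \<Delta>')" if sub: "fset \<Gamma>' \<subseteq> L" "fset \<Delta>' \<inter> L = {}" for \<Gamma>' \<Delta>'
  proof
    assume der: "derivable K I (\<Gamma>' \<Turnstile> \<Delta>')"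
    obtain m n where mn: "\<Gamma>' |\<subseteq>| G m" "\<Delta>' |\<subseteq>| D n"
      using subG[OF sub(1)] subD[OF sub(2)] by blast
    have "\<Gamma>' |\<subseteq>| G (max m n)" "\<Delta>' |\<subseteq>| D (max m n)"
      using mn monoG[of m "max m n"] monoD[of n "max m n"] by auto
    then show False using derivable_weaken[OF der] nd by blast
  qed
  have henkin: "\<exists>u\<ge>m. free_for (V u) v \<psi> \<and> subst \<psi> v (V u) \<notin> L" if "All v \<psi> \<notin> L" for v \<psi> m
  proof -
    obtain n where n: "n \<ge> m" "fml n = All v \<psi>" using handled by blast
    then have "fml n |\<notin>| G (Suc n)" using that by (auto simp: L_def)
    then obtain u where "u \<ge> n" "free_for (V u) v \<psi>" "subst \<psi> v (V u) |\<in>| D (Suc n)"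
      using s(2)[of n] n unfolding R_def G_def D_def by blast
    then show ?thesis using n disj by (meson order_trans)
  qed
  have start: "\<Gamma> |\<subseteq>| G 0" "\<Delta> |\<subseteq>| D 0" using s(1)[of 0] by (simp_all add: P_def G_def D_def)
  show ?thesis
  proof (rule that)
    show "saturated K I L" using cons henkin by (simp add: saturated_def)
    show "fset \<Gamma> \<subseteq> L" using start(1) by (auto simp: L_def)
    show "fset \<Delta> \<inter> L = {}" using start(2) disj[of _ 0] by auto
  qed
qed

section \<open>The term model of a saturated set\<close>

lemma fresh_tm: "max_tm t \<le> v \<Longrightarrow> v \<notin> tv t"
  by (auto dest: tv_max)

lemma literal_intros: "literal (Eq s t)" "literal (Tr t)"
  by (auto simp: literal_def atomic_def)

lemma numeral_tm_simps [simp]: "numeral_tm 0 = Zero" "numeral_tm (Suc n) = Sc (numeral_tm n)"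
  by (simp_all add: numeral_tm_def)

lemma tv_numeral [simp]: "tv (numeral_tm n) = {}"
  by (induction n) auto

context
  fixes K I L
  assumes saturated: "saturated K I L"
begin

lemma saturated_derivable:
  "derivable K I (\<Gamma> \<Turnstile> \<Delta>) \<Longrightarrow> fset \<Gamma> \<subseteq> L \<Longrightarrow> \<exists>\<delta>\<in>fset \<Delta>. \<delta> \<in> L"
  using saturated unfolding saturated_def by blast

lemma saturated_Neg: "Neg \<phi> \<in> L \<longleftrightarrow> \<phi> \<notin> L"
proof -
  have "derivable K I ({|Neg \<phi>, \<phi>|} \<Turnstile> {||})"
    by (rule derivable_step[OF NegL]) (simp add: derivable_identity[of \<phi>])
  moreover have "derivable K I ({||} \<Turnstile> {|Neg \<phi>, \<phi>|})"
    by (rule derivable_step[OF NegR]) (simp add: derivable_identity[of \<phi>])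
  ultimately show ?thesis using saturated_derivable by fastforce
qed

lemma saturated_And: "And \<phi> \<psi> \<in> L \<longleftrightarrow> \<phi> \<in> L \<and> \<psi> \<in> L"
proof -
  have "derivable K I ({|And \<phi> \<psi>|} \<Turnstile> {|\<phi>|})"
    by (rule derivable_step[OF AndL]) (simp add: derivable_identity[of \<phi>])
  moreover have "derivable K I ({|And \<phi> \<psi>|} \<Turnstile> {|\<psi>|})"
    by (rule derivable_step[OF AndL]) (simp add: derivable_identity[of \<psi>])
  moreover have "derivable K I ({|\<phi>, \<psi>|} \<Turnstile> {|And \<phi> \<psi>|})"
    by (rule derivable_step[OF AndR]) (simp add: derivable_identity[of \<phi>] derivable_identity[of \<psi>])
  ultimately show ?thesis using saturated_derivable by fastforce
qed

lemma saturated_All: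
  assumes "All v \<phi> \<in> L" "free_for t v \<phi>"
  shows "subst \<phi> v t \<in> L"
proof -
  have "derivable K I ({|All v \<phi>|} \<Turnstile> {|subst \<phi> v t|})"
    by (rule derivable_step[OF AllL[OF assms(2)]]) (simp add: derivable_identity[of "subst \<phi> v t"])
  from saturated_derivable[OF this] show ?thesis using assms by auto
qed

lemma saturated_Henkin:
  "All v \<phi> \<notin> L \<Longrightarrow> \<exists>u\<ge>m. free_for (V u) v \<phi> \<and> subst \<phi> v (V u) \<notin> L"
  using saturated unfolding saturated_def by blast

lemma saturated_refl: "Eq t t \<in> L"
proof -
  have "derivable K I ({||} \<Turnstile> {|Eq t t|})"
    by (rule derivable_step[OF Ref[of _ _ t]]) (simp add: derivable_identity[of "Eq t t"])
  from saturated_derivable[OF this] show ?thesis by auto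
qed

lemma saturated_repl:
  assumes "literal \<phi>" "Eq s t \<in> L" "subst \<phi> v s \<in> L"
  shows "subst \<phi> v t \<in> L"
proof -
  have "derivable K I ({|Eq s t, subst \<phi> v s|} |\<union>| {||} \<Turnstile> {|subst \<phi> v t|})"
    by (rule derivable_step[OF RepL[OF assms(1)]]) (simp add: derivable_identity[of "subst \<phi> v t"])
  from saturated_derivable[OF this] show ?thesis using assms by auto
qed

text \<open>The variable with index \<open>max_tm s\<close> does not occur in \<open>s\<close> and
  marks the single place where replacement happens. The laws below use placeholders in the same
  way.\<close>

lemma saturated_sym: "Eq s t \<in> L \<Longrightarrow> Eq t s \<in> L"
  using saturated_repl[of "Eq (V (max_tm s)) s" s t "max_tm s"] saturated_refl
  by (simp add: literal_intros fresh_tm)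

lemma saturated_trans: "Eq r s \<in> L \<Longrightarrow> Eq s t \<in> L \<Longrightarrow> Eq r t \<in> L"
  using saturated_repl[of "Eq r (V (max_tm r))" s t "max_tm r"]
  by (simp add: literal_intros fresh_tm)

lemma saturated_Tr: "Eq s t \<in> L \<Longrightarrow> Tr s \<in> L \<Longrightarrow> Tr t \<in> L"
  using saturated_repl[of "Tr (V 0)" s t 0] by (simp add: literal_intros)

lemma saturated_F1: "Eq s t \<in> L \<Longrightarrow> Eq (F1 f s) (F1 f t) \<in> L"
  using saturated_repl[of "Eq (F1 f s) (F1 f (V (max_tm s)))" s t "max_tm s"] saturated_refl
  by (simp add: literal_intros fresh_tm)

lemma saturated_F2:
  assumes "Eq s t \<in> L" "Eq s' t' \<in> L"
  shows "Eq (F2 f s s') (F2 f t t') \<in> L"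
proof -
  let ?v = "max (max_tm s) (max (max_tm s') (max_tm t))"
  have "Eq (F2 f s s') (F2 f t s') \<in> L"
    using saturated_repl[of "Eq (F2 f s s') (F2 f (V ?v) s')" s t ?v] saturated_refl assms
    by (simp add: literal_intros fresh_tm)
  then show ?thesis
    using saturated_repl[of "Eq (F2 f s s') (F2 f t (V ?v))" s' t' ?v] assms
    by (simp add: literal_intros fresh_tm)
qed

text \<open>Were the universal formula saying that nothing equals \<open>t\<close> in
  \<open>L\<close>, its instance at \<open>t\<close> would contradict reflexivity. So it is outside
  \<open>L\<close>, and the Henkin property supplies the variable.\<close>

lemma saturated_name: "\<exists>u\<ge>m. Eq (V u) t \<in> L"
proof -
  let ?w = "max_tm t"
  have "All ?w (Neg (Eq (V ?w) t)) \<notin> L"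
  proof
    assume "All ?w (Neg (Eq (V ?w) t)) \<in> L"
    from saturated_All[OF this, of t] show False
      using saturated_refl by (simp add: fresh_tm saturated_Neg)
  qed
  from saturated_Henkin[OF this, of m] show ?thesis by (auto simp: fresh_tm saturated_Neg)
qed

lemma saturated_pa: "pa_axiom \<phi> \<Longrightarrow> \<phi> \<in> L"
  using saturated_derivable[OF derivable_step[OF PA]] by fastforce

text \<open>This makes the quotient of the terms infinite.\<close>

lemma saturated_numerals:
  assumes "m < n" shows "Eq (numeral_tm n) (numeral_tm m) \<notin> L"
  using assms
proof (induction m arbitrary: n)
  case 0
  then obtain k where n: "n = Suc k" by (cases n) auto
  have "Neg (Eq (Sc (V 0)) Zero) \<in> defining_axioms"
    unfolding defining_axioms_def Let_def by blast
  from saturated_pa[OF pa_axiom.defining[OF this]]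
  have "All 0 (Neg (Eq (Sc (V 0)) Zero)) \<in> L" by (simp add: univ_closure_def)
  from saturated_All[OF this, of "numeral_tm k"] show ?case using n by (simp add: saturated_Neg)
next
  case (Suc m)
  then obtain k where n: "n = Suc k" by (cases n) auto
  have "Imp (Eq (Sc (V 0)) (Sc (V 1))) (Eq (V 0) (V 1)) \<in> defining_axioms"
    unfolding defining_axioms_def Let_def by blast
  from saturated_pa[OF pa_axiom.defining[OF this]]
  have "All 0 (All 1 (Imp (Eq (Sc (V 0)) (Sc (V 1))) (Eq (V 0) (V 1)))) \<in> L"
    by (simp add: univ_closure_def)
  from saturated_All[OF this, of "numeral_tm k"]
  have "All 1 (Imp (Eq (Sc (numeral_tm k)) (Sc (V 1))) (Eq (numeral_tm k) (V 1))) \<in> L" by simp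
  from saturated_All[OF this, of "numeral_tm m"] show ?case
    using n Suc by (simp add: saturated_Neg saturated_And)
qed

text \<open>There are countably many classes, and infinitely many because of the numerals, so all
  natural numbers can index them. Hence one domain type, \<open>nat\<close>, serves every
  countermodel.\<close>

lemma term_quotient: "\<exists>q :: tm \<Rightarrow> nat. surj q \<and> (\<forall>s t. q s = q t \<longleftrightarrow> Eq s t \<in> L)"
proof -
  define cls where "cls t = {s. Eq t s \<in> L}" for t
  have cls: "cls s = cls t \<longleftrightarrow> Eq s t \<in> L" for s t
  proof
    assume "cls s = cls t"
    then show "Eq s t \<in> L" using saturated_refl[of t] by (auto simp: cls_def)
  qed (auto simp: cls_def intro: saturated_sym saturated_trans)
  have "inj (\<lambda>n. cls (numeral_tm n))"
    by (rule injI) (metis cls saturated_numerals linorder_neqE_nat saturated_sym)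
  then have "infinite (range (\<lambda>n. cls (numeral_tm n)))" by (rule range_inj_infinite)
  then have inf: "infinite (range cls)" by (rule infinite_super[rotated]) auto
  have "countable (range cls)" by auto
  then have bij: "bij_betw (to_nat_on (range cls)) (range cls) UNIV"
    using inf by (rule to_nat_on_infinite)
  let ?q = "\<lambda>t. to_nat_on (range cls) (cls t)"
  have "range ?q = UNIV" using bij by (simp add: bij_betw_def image_image[symmetric] del: image_image)
  moreover have "?q s = ?q t \<longleftrightarrow> Eq s t \<in> L" for s t
    using bij cls[of s t] by (auto simp: bij_betw_def inj_on_def)
  ultimately show ?thesis by blast
qed

text \<open>Functions and truth are read off representatives chosen by \<open>inv q\<close>; the
  congruence laws in \<open>L\<close> make the choice irrelevant. Under the assignment of each
  variable to its own class, satisfaction is membership in \<open>L\<close>.\<close>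

lemma ex_model: "\<exists>(M :: nat interp) e. is_model K I M \<and> (\<forall>\<phi>. sat M e \<phi> \<longleftrightarrow> \<phi> \<in> L)"
proof -
  obtain q :: "tm \<Rightarrow> nat" where surj: "surj q" and q: "\<And>s t. q s = q t \<longleftrightarrow> Eq s t \<in> L"
    using term_quotient by blast
  have inv: "Eq (inv q (q t)) t \<in> L" for t using surj q by (metis surj_f_inv_f)
  define M where "M = \<lparr>zero = q Zero, fun1 = (\<lambda>f a. q (F1 f (inv q a))),
    fun2 = (\<lambda>f a b. q (F2 f (inv q a) (inv q b))), truth = {a. Tr (inv q a) \<in> L}\<rparr>"
  define e where "e i = q (V i)" for i
  have "fun1 M f (q t) = q (F1 f t)" "fun2 M g (q s) (q t) = q (F2 g s t)" "zero M = q Zero" for f g s t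
    by (simp_all add: M_def q saturated_F1 saturated_F2 inv)
  then have ev: "ev M e t = q t" for t by (induction t) (simp_all add: e_def)
  have truth: "q t \<in> truth M \<longleftrightarrow> Tr t \<in> L" for t
  proof -
    have "q t \<in> truth M \<longleftrightarrow> Tr (inv q (q t)) \<in> L" by (simp add: M_def)
    also have "\<dots> \<longleftrightarrow> Tr t \<in> L"
      using saturated_Tr[OF inv[of t]] saturated_Tr[OF saturated_sym[OF inv[of t]]] by blast
    finally show ?thesis .
  qed
  have tr: "sat M e \<phi> \<longleftrightarrow> \<phi> \<in> L" for \<phi>
  proof (induction "complexity \<phi>" arbitrary: \<phi> rule: less_induct)
    case less
    show ?case
    proof (cases \<phi>)
      case (Tr t)
      then show ?thesis by (simp add: ev truth)
    next
      case (All v \<psi>)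
      show ?thesis
      proof
        assume "sat M e \<phi>"
        show "\<phi> \<in> L"
        proof (rule ccontr)
          assume "\<phi> \<notin> L"
          then obtain u where u: "free_for (V u) v \<psi>" "subst \<psi> v (V u) \<notin> L"
            using saturated_Henkin All by blast
          then have "\<not> sat M e (subst \<psi> v (V u))" using less[of "subst \<psi> v (V u)"] All by simp
          then show False using \<open>sat M e \<phi>\<close> All u by (simp add: sat_subst)
        qed
      next
        assume "\<phi> \<in> L"
        have "sat M (e(v := d)) \<psi>" for d
        proof -
          obtain t where "d = q t" using surj by blast
          \<comment> \<open>The term \<open>t\<close> might be captured when substituted into
            \<psi>; a variable equal to it and beyond \<open>max_fm \<psi>\<close> is not.\<close>
          moreover obtain u where u: "u \<ge> max_fm \<psi>" "Eq (V u) t \<in> L"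
            using saturated_name by blast
          ultimately have d: "d = ev M e (V u)" by (simp add: e_def q saturated_sym)
          have ff: "free_for (V u) v \<psi>" using u by (simp add: free_for_fresh)
          then have "subst \<psi> v (V u) \<in> L" using \<open>\<phi> \<in> L\<close> All saturated_All by blast
          then have "sat M e (subst \<psi> v (V u))" using less[of "subst \<psi> v (V u)"] All by simp
          then show ?thesis using d ff by (simp add: sat_subst)
        qed
        then show "sat M e \<phi>" using All by simp
      qed
    qed (simp_all add: less ev q saturated_Neg saturated_And)
  qed
  have "sequent_sat M e' S" if der: "derivable K I S" for S e'
  proof -
    obtain \<chi> where \<chi>: "derivable K I ({||} \<Turnstile> {|\<chi>|})" "\<And>e. sat M e \<chi> \<longleftrightarrow> sequent_sat M e S"
      using derivable_sequent_formula[OF der] by blast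
    \<comment> \<open>Membership in \<open>L\<close> describes satisfaction at \<open>e\<close>
      only; the universal closure reaches the other assignments.\<close>
    have "derivable K I ({||} \<Turnstile> {|univ_closure \<chi>|})"
      unfolding univ_closure_def by (rule derivable_closure[OF \<chi>(1)])
    from saturated_derivable[OF this] have "sat M e (univ_closure \<chi>)" by (simp add: tr)
    then show ?thesis using \<chi>(2) by (simp add: sat_univ_closure)
  qed
  then show ?thesis using tr unfolding is_model_def by blast
qed

end

theorem completeness:
  assumes "\<And>(M :: nat interp) e. is_model K I M \<Longrightarrow> sequent_sat M e S"
  shows "derivable K I S"
proof (rule ccontr)
  assume nd: "\<not> derivable K I S"
  obtain \<Gamma> \<Delta> where S: "S = (\<Gamma> \<Turnstile> \<Delta>)" by (cases S)
  obtain L where L: "saturated K I L" "fset \<Gamma> \<subseteq> L" "fset \<Delta> \<inter> L = {}"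
    using ex_saturated nd S by blast
  obtain M :: "nat interp" and e where "is_model K I M" "\<And>\<phi>. sat M e \<phi> \<longleftrightarrow> \<phi> \<in> L"
    using ex_model[OF L(1)] by blast
  then show False using assms[of M e] L S by auto
qed

section \<open>Arithmetic in a model\<close>

lemma sat_Disj: "sat M e (Disj \<phi>s) \<longleftrightarrow> (\<exists>\<phi>\<in>set \<phi>s. sat M e \<phi>)"
  by (induction \<phi>s) (auto simp: Disj_def)

lemma arithmetical_Disj: "arithmetical (Disj \<phi>s) \<longleftrightarrow> (\<forall>\<phi>\<in>set \<phi>s. arithmetical \<phi>)"
  by (induction \<phi>s) (auto simp: Disj_def)

lemma fresh_notin: "t \<in> set ts \<Longrightarrow> fresh ts \<notin> tv t"
proof -
  assume t: "t \<in> set ts"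
  have "\<exists>i. \<forall>t\<in>set ts. \<forall>j\<in>tv t. j < i"
  proof
    have "finite (\<Union>t\<in>set ts. tv t)" by simp
    then show "\<forall>t\<in>set ts. \<forall>j\<in>tv t. j < Suc (Max (\<Union>t\<in>set ts. tv t))"
      by (auto simp: less_Suc_eq_le intro!: Max_ge)
  qed
  from LeastI_ex[OF this] t show ?thesis unfolding fresh_def by blast
qed

lemma UNIV_fn1: "UNIV = {SucF, NumF, VarF, TermF, FmlF}"
  using fn1.exhaust by auto

lemma UNIV_fn2: "UNIV = {AddF, MulF, ConsF, MemF, SubF, FreeF, CntF}"
  using fn2.exhaust by auto

lemma tag1_simps [simp]:
  "tag1 f = tag1 f' \<longleftrightarrow> f = f'" "tag1 f \<noteq> 0" "tag1 f \<noteq> Suc 0" "tag1 f \<noteq> 18"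
  by (cases f; cases f'; simp)+

lemma tag2_simps [simp]:
  "tag2 g = tag2 g' \<longleftrightarrow> g = g'" "tag2 g \<noteq> 0" "tag2 g \<noteq> Suc 0" "tag2 g \<noteq> 18"
  by (cases g; cases g'; simp)+

lemma tag1_tag2 [simp]: "tag1 f \<noteq> tag2 g" "tag2 g \<noteq> tag1 f"
  by (cases f; cases g; simp)+

locale kf_model =
  fixes K :: truth_theory and I :: induction_version and M :: "'a interp"
  assumes model: "is_model K I M"
begin

abbreviation zer :: 'a ("\<zero>") where "\<zero> \<equiv> zero M"
abbreviation suc :: "'a \<Rightarrow> 'a" where "suc \<equiv> fun1 M SucF"
abbreviation one :: 'a ("\<one>") where "\<one> \<equiv> suc \<zero>"
abbreviation numc :: "'a \<Rightarrow> 'a" where "numc \<equiv> fun1 M NumF"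
abbreviation pr :: "'a \<Rightarrow> 'a \<Rightarrow> 'a" where "pr \<equiv> fun2 M ConsF"
abbreviation mem :: "'a \<Rightarrow> 'a \<Rightarrow> bool" where "mem x c \<equiv> fun2 M MemF x c = \<one>"
abbreviation sub :: "'a \<Rightarrow> 'a \<Rightarrow> 'a \<Rightarrow> 'a" where "sub x y v \<equiv> fun2 M SubF x (pr y v)"
abbreviation isfree :: "'a \<Rightarrow> 'a \<Rightarrow> bool" where "isfree w x \<equiv> fun2 M FreeF w x = \<one>"
abbreviation cnt :: "'a \<Rightarrow> 'a \<Rightarrow> 'a" where "cnt \<equiv> fun2 M CntF"
abbreviation isvar :: "'a \<Rightarrow> bool" where "isvar x \<equiv> fun1 M VarF x = \<one>"
abbreviation isterm :: "'a \<Rightarrow> bool" where "isterm x \<equiv> fun1 M TermF x = \<one>"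
abbreviation isfml :: "'a \<Rightarrow> bool" where "isfml x \<equiv> fun1 M FmlF x = \<one>"
abbreviation var :: "'a \<Rightarrow> 'a" where "var i \<equiv> pr \<zero> i"

primrec nm :: "nat \<Rightarrow> 'a" where
  "nm 0 = \<zero>"
| "nm (Suc n) = suc (nm n)"

abbreviation nd :: "nat \<Rightarrow> 'a \<Rightarrow> 'a \<Rightarrow> 'a" where "nd h l r \<equiv> pr (nm h) (pr l r)"

lemma ev_numeral [simp]: "ev M e (numeral_tm n) = nm n"
  by (induction n) simp_all

lemma derivable_sat: "derivable K I S \<Longrightarrow> sequent_sat M e S"
  using model by (simp add: is_model_def)

lemma pa_sat: "pa_axiom \<phi> \<Longrightarrow> sat M e \<phi>"
  using derivable_sat[OF derivable_step[OF PA], of \<phi> e] by simp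

lemma defining_sat: "\<phi> \<in> defining_axioms \<Longrightarrow> sat M e \<phi>"
  using pa_sat[OF pa_axiom.defining] by (simp add: sat_univ_closure)

lemma defining_axioms_sat: "\<forall>\<phi>\<in>defining_axioms. sat M e \<phi>"
  by (simp add: defining_sat)

lemma axioms:
  "suc x \<noteq> \<zero>"
  "suc x = suc y \<longrightarrow> x = y"
  "fun2 M AddF x \<zero> = x"
  "pr \<zero> \<zero> = \<one>"
  "pr \<zero> (suc y) = suc (pr y \<zero>)"
  "pr (suc x) y = suc (pr x (suc y))"
  "fun2 M MemF x \<zero> = \<zero>"
  "mem x (pr x z)"
  "x = y \<or> fun2 M MemF x (pr y z) = fun2 M MemF x z"
  "numc \<zero> = nm (cons (Suc 0) 0)"
  "numc (suc x) = nd 2 (numc x) \<zero>"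
  "sub \<zero> y v = \<zero>"
  "sub (var z) y (var z) = y"
  "var z = v \<or> sub (var z) y v = var z"
  "sub (pr (suc h) \<zero>) y v = pr (suc h) \<zero>"
  "sub (nd 18 v r) y v = nd 18 v r"
  "suc h = nm 18 \<and> l = v \<or> sub (pr (suc h) (pr l r)) y v = pr (suc h) (pr (sub l y v) (sub r y v))"
  "fun2 M FreeF w x = \<zero> \<or> isfree w x"
  "fun2 M FreeF w \<zero> = \<zero>"
  "isfree w (var z) \<longrightarrow> w = var z"
  "fun2 M FreeF w (pr (suc h) \<zero>) = \<zero>"
  "fun2 M FreeF w (nd 18 w r) = \<zero>"
  "suc h = nm 18 \<and> l = w \<or> (isfree w (pr (suc h) (pr l r)) \<longrightarrow> isfree w l \<or> isfree w r) \<and>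
    (fun2 M FreeF w l \<noteq> \<one> \<and> fun2 M FreeF w r \<noteq> \<one> \<or> isfree w (pr (suc h) (pr l r)))"
  "cnt \<zero> x = \<zero>"
  "cnt (suc y) x = fun2 M AddF (cnt y x) (fun2 M FreeF (var y) x)"
  "isvar (var z)"
  "isterm (var z)"
  "suc h = \<one> \<longrightarrow> isterm (pr \<one> \<zero>)"
  \<comment> \<open>The list assigns values to \<open>V 0\<close> up to \<open>V 7\<close> in the
    order in which the axioms name these variables.\<close>
  using defining_axioms_sat[of "\<lambda>i. [x, y, z, h, l, r, v, w] ! i", unfolded defining_axioms_def Let_def ball_simps
      quote_tm_def sat.simps ev.simps ev_numeral nth_Cons_0 nth_Cons_numeral nth_Cons_Suc, simplified]
  by - (elim conjE, assumption)+

lemma isterm_node_iff: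
  "isterm (pr (suc h) (pr l r)) \<longleftrightarrow>
     (\<exists>f. suc h = nm (tag1 f)) \<and> isterm l \<and> r = \<zero> \<or> (\<exists>f. suc h = nm (tag2 f)) \<and> isterm l \<and> isterm r"
proof -
  have tags: "(\<exists>f. a = nm (tag1 f)) \<longleftrightarrow> (\<exists>f\<in>{SucF, NumF, VarF, TermF, FmlF}. a = nm (tag1 f))"
    "(\<exists>f. a = nm (tag2 f)) \<longleftrightarrow> (\<exists>f\<in>{AddF, MulF, ConsF, MemF, SubF, FreeF, CntF}. a = nm (tag2 f))" for a
    unfolding UNIV_fn1[symmetric] UNIV_fn2[symmetric] by simp_all
  let ?h = "Sc (V 3)" and ?l = "V 4" and ?r = "V 5"
  have "Iff (IsTerm (Pr ?h (Pr ?l ?r)))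
         (Or (And (Disj (map (\<lambda>f. is_tag ?h (tag1 f)) [SucF, NumF, VarF, TermF, FmlF]))
                  (And (IsTerm ?l) (Eq ?r Zero)))
             (And (Disj (map (\<lambda>f. is_tag ?h (tag2 f))
                         [AddF, MulF, ConsF, MemF, SubF, FreeF, CntF]))
                  (And (IsTerm ?l) (IsTerm ?r)))) \<in> defining_axioms"
    unfolding defining_axioms_def Let_def by blast
  \<comment> \<open>The default value \<open>r\<close> is there for \<open>V 5\<close>.\<close>
  from defining_sat[OF this, of "(\<lambda>_. r)(3 := h, 4 := l)"] show ?thesis
    unfolding tags by (simp add: sat_Disj) blast
qed

lemma isfml_node_iff:
  "isfml (pr (suc h) (pr l r)) \<longleftrightarrow>
     suc h = nm 14 \<and> isterm l \<and> isterm r \<or> suc h = nm 15 \<and> isterm l \<and> r = \<zero> \<or>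
     suc h = nm 16 \<and> isfml l \<and> r = \<zero> \<or> suc h = nm 17 \<and> isfml l \<and> isfml r \<or>
     suc h = nm 18 \<and> isvar l \<and> isfml r"
proof -
  let ?h = "Sc (V 3)" and ?l = "V 4" and ?r = "V 5"
  have "Iff (IsFml (Pr ?h (Pr ?l ?r)))
         (Disj [And (is_tag ?h tagEq) (And (IsTerm ?l) (IsTerm ?r)),
                And (is_tag ?h tagT) (And (IsTerm ?l) (Eq ?r Zero)),
                And (is_tag ?h tagNeg) (And (IsFml ?l) (Eq ?r Zero)),
                And (is_tag ?h tagAnd) (And (IsFml ?l) (IsFml ?r)),
                And (is_tag ?h tagAll) (And (IsVar ?l) (IsFml ?r))]) \<in> defining_axioms"
    unfolding defining_axioms_def Let_def by blast
  from defining_sat[OF this, of "(\<lambda>_. r)(3 := h, 4 := l)"] show ?thesis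
    by (simp add: sat_Disj) blast
qed


section \<open>Induction and pairing inside the model\<close>

text \<open>The axiom is universally closed, so \<phi> may have arbitrary elements of the model as
  parameters through \<open>e\<close>. Restricting \<phi> to arithmetical formulae keeps this
  available in all the theories.\<close>

lemma model_induct:
  assumes "arithmetical \<phi>" "sat M (e(i := \<zero>)) \<phi>"
    "\<And>d. sat M (e(i := d)) \<phi> \<Longrightarrow> sat M (e(i := suc d)) \<phi>"
  shows "sat M (e(i := d)) \<phi>"
proof -
  have "free_for (Sc (V i)) i \<phi>" by (induction \<phi>) auto
  then have "sat M e (Imp (And (subst \<phi> i Zero) (All i (Imp \<phi> (subst \<phi> i (Sc (V i)))))) (All i \<phi>))
      \<longleftrightarrow> (sat M (e(i := \<zero>)) \<phi> \<and> (\<forall>d. sat M (e(i := d)) \<phi> \<longrightarrow> sat M (e(i := suc d)) \<phi>)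
        \<longrightarrow> (\<forall>d. sat M (e(i := d)) \<phi>))"
    by (simp add: sat_subst free_for_closed) blast
  moreover have "sat M e (Imp (And (subst \<phi> i Zero) (All i (Imp \<phi> (subst \<phi> i (Sc (V i)))))) (All i \<phi>))"
    using pa_sat[OF pa_axiom.induction[OF assms(1)]] by (simp only: sat_univ_closure)
  ultimately show ?thesis using assms(2,3) by blast
qed

lemma zero_or_suc: "x = \<zero> \<or> (\<exists>y. x = suc y)"
  using model_induct[of "Or (Eq (V 0) Zero) (Exi 1 (Eq (V 0) (Sc (V 1))))" "\<lambda>_. x" 0 x] by auto

lemma suc_simps [simp]: "suc x \<noteq> \<zero>" "\<zero> \<noteq> suc x" "suc x = suc y \<longleftrightarrow> x = y"
  using axioms(1,2) by (metis, metis, blast)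

lemma nm_eq [simp]: "nm m = nm n \<longleftrightarrow> m = n"
proof (induction m arbitrary: n)
  case 0
  then show ?case by (cases n) auto
next
  case (Suc m)
  then show ?case by (cases n) auto
qed

lemma nm_zero [simp]: "nm n = \<zero> \<longleftrightarrow> n = 0" "\<zero> = nm n \<longleftrightarrow> n = 0"
  using nm_eq[of n 0] nm_eq[of 0 n] by (simp_all del: nm_eq)

lemma nm_one [simp]: "nm n = \<one> \<longleftrightarrow> n = 1"
  using nm_eq[of n 1] by (simp del: nm_eq)

lemma pr_cases:
  obtains "a = \<zero>" "b = \<zero>" "pr a b = suc \<zero>"
  | b' where "a = \<zero>" "b = suc b'" "pr a b = suc (pr b' \<zero>)"
  | a' where "a = suc a'" "pr a b = suc (pr a' (suc b))"
  using zero_or_suc[of a] zero_or_suc[of b] axioms(4-6) by metis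

lemma pr_nonzero [simp]: "pr a b \<noteq> \<zero>" "\<zero> \<noteq> pr a b"
  by (cases rule: pr_cases[of a b]; simp)+

text \<open>Along Cantor's enumeration, each pair other than the first has a value one above that of
  its predecessor. Induction is on the common value \<open>n\<close>, with all four components
  quantified inside the formula because the predecessor changes them.\<close>

lemma pr_inj: "pr a b = n \<and> pr c d = n \<longrightarrow> a = c \<and> b = d"
proof -
  let ?\<phi> = "All 1 (All 2 (All 3 (All 4 (Imp (And (Eq (Pr (V 1) (V 2)) (V 0)) (Eq (Pr (V 3) (V 4)) (V 0)))
    (And (Eq (V 1) (V 3)) (Eq (V 2) (V 4)))))))"
  have "sat M ((\<lambda>_. n)(0 := n)) ?\<phi>"
  proof (rule model_induct)
    fix m
    assume "sat M ((\<lambda>_. n)(0 := m)) ?\<phi>"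
    from this[simplified] have IH': "pr a b = m \<Longrightarrow> pr c d = m \<Longrightarrow> a = c \<and> b = d" for a b c d
      by blast
    have "\<forall>a b c d. pr a b = suc m \<and> pr c d = suc m \<longrightarrow> a = c \<and> b = d"
    proof (intro allI impI)
      fix a b c d
      assume eq: "pr a b = suc m \<and> pr c d = suc m"
      have pred: "a = \<zero> \<and> b = \<zero> \<and> m = \<zero> \<or> (\<exists>b'. a = \<zero> \<and> b = suc b' \<and> pr b' \<zero> = m) \<or>
          (\<exists>a'. a = suc a' \<and> pr a' (suc b) = m)" if eq: "pr a b = suc m" for a b
        using eq by (cases rule: pr_cases[of a b]) simp_all
      show "a = c \<and> b = d"
        by (insert pred[OF conjunct1[OF eq]] pred[OF conjunct2[OF eq]], elim disjE exE conjE; (drule (1) IH')?; simp)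
    qed
    then show "sat M ((\<lambda>_. n)(0 := suc m)) ?\<phi>"
      by - (simp (no_asm), blast)
  qed simp_all
  from this[simplified] show ?thesis by blast
qed

lemma pr_eq [simp]: "pr a b = pr c d \<longleftrightarrow> a = c \<and> b = d"
  using pr_inj by blast

lemma prod_encode_step: "prod_encode (0, Suc y) = Suc (prod_encode (y, 0))"
  "prod_encode (Suc x, y) = Suc (prod_encode (x, Suc y))"
  by (simp_all add: prod_encode_def)

text \<open>An induction outside the model: for standard arguments the recursion equations compute
  the actual \<open>cons\<close>. This is what ties numerals of Goedel numbers to expressions built
  in the model.\<close>

lemma pr_nm: "pr (nm a) (nm b) = nm (cons a b)"
proof -
  have "prod_encode (a, b) = n \<Longrightarrow> pr (nm a) (nm b) = nm (Suc n)" for n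
  proof (induction n arbitrary: a b rule: less_induct)
    case (less n)
    consider "a = 0" "b = 0" | y where "a = 0" "b = Suc y" | x where "a = Suc x"
      by (cases a; cases b) auto
    then show ?case
    proof cases
      case 1
      then show ?thesis using less.prems axioms(4) by (simp add: prod_encode_def)
    next
      case 2
      then show ?thesis using less.prems less.IH[of "prod_encode (y, 0)" y 0] axioms(5)
        by (auto simp: prod_encode_step)
    next
      case 3
      then show ?thesis using less.prems less.IH[of "prod_encode (x, Suc b)" x "Suc b"] axioms(6)
        by (auto simp: prod_encode_step)
    qed
  qed
  then show ?thesis by (simp add: cons_def)
qed

section \<open>Codes of expressions in a model\<close>

text \<open>The element coding \<open>t\<close> with each variable \<open>i \<notin> B\<close> replaced by the numeral of \<open>e i\<close>; since
  \<open>e i\<close> may be nonstandard, so may this element.\<close>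

primrec code_tm :: "(nat \<Rightarrow> 'a) \<Rightarrow> nat set \<Rightarrow> tm \<Rightarrow> 'a" where
  "code_tm e B (V i) = (if i \<in> B then var (nm i) else numc (e i))"
| "code_tm e B Zero = pr (nm 1) \<zero>"
| "code_tm e B (F1 f t) = nd (tag1 f) (code_tm e B t) \<zero>"
| "code_tm e B (F2 f s t) = nd (tag2 f) (code_tm e B s) (code_tm e B t)"

primrec code_fm :: "(nat \<Rightarrow> 'a) \<Rightarrow> nat set \<Rightarrow> fm \<Rightarrow> 'a" where
  "code_fm e B (Eq s t) = nd 14 (code_tm e B s) (code_tm e B t)"
| "code_fm e B (Tr t) = nd 15 (code_tm e B t) \<zero>"
| "code_fm e B (Neg \<phi>) = nd 16 (code_fm e B \<phi>) \<zero>"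
| "code_fm e B (And \<phi> \<psi>) = nd 17 (code_fm e B \<phi>) (code_fm e B \<psi>)"
| "code_fm e B (All i \<phi>) = nd 18 (var (nm i)) (code_fm e (insert i B) \<phi>)"

lemma code_tm_cong:
  "(\<And>i. i \<in> tv t \<Longrightarrow> (i \<in> B \<longleftrightarrow> i \<in> B') \<and> (i \<in> B \<or> e i = e' i)) \<Longrightarrow> code_tm e B t = code_tm e' B' t"
  by (induction t) auto

lemma code_fm_cong:
  "(\<And>i. i \<in> fv \<phi> \<Longrightarrow> (i \<in> B \<longleftrightarrow> i \<in> B') \<and> (i \<in> B \<or> e i = e' i)) \<Longrightarrow> code_fm e B \<phi> = code_fm e' B' \<phi>"
proof (induction \<phi> arbitrary: B B')
  case (Eq s t)
  have "code_tm e B s = code_tm e' B' s" by (rule code_tm_cong) (use Eq in auto)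
  moreover have "code_tm e B t = code_tm e' B' t" by (rule code_tm_cong) (use Eq in auto)
  ultimately show ?case by simp
next
  case (Tr t)
  have "code_tm e B t = code_tm e' B' t" by (rule code_tm_cong) (use Tr in auto)
  then show ?case by simp
next
  case (Neg \<phi>)
  have "code_fm e B \<phi> = code_fm e' B' \<phi>" by (rule Neg.IH) (use Neg.prems in auto)
  then show ?case by simp
next
  case (And \<phi> \<psi>)
  have "code_fm e B \<phi> = code_fm e' B' \<phi>" by (rule And.IH) (use And.prems in auto)
  moreover have "code_fm e B \<psi> = code_fm e' B' \<psi>" by (rule And.IH) (use And.prems in auto)
  ultimately show ?case by simp
next
  case (All i \<phi>)
  have "code_fm e (insert i B) \<phi> = code_fm e' (insert i B') \<phi>" by (rule All.IH) (use All.prems in auto)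
  then show ?case by simp
qed

text \<open>Taking \<open>UNIV\<close> for \<open>B\<close> leaves every variable in place, which
  gives the ordinary Goedel number.\<close>

lemma nm_gn_tm: "nm (gn_tm t) = code_tm e UNIV t"
  by (induction t) (simp_all add: pr_nm[symmetric])

lemma nm_gn: "nm (gn \<phi>) = code_fm e UNIV \<phi>"
  by (induction \<phi>) (simp_all add: pr_nm[symmetric] nm_gn_tm[of _ e])

lemma numc_simps [simp]: "numc \<zero> = pr \<one> \<zero>" "numc (suc x) = nd 2 (numc x) \<zero>"
  using axioms(10,11) pr_nm[of 1 0] by simp_all

lemma sub_pr_zero [simp]: "h \<noteq> \<zero> \<Longrightarrow> sub (pr h \<zero>) y v = pr h \<zero>"
  using axioms(15) zero_or_suc[of h] by metis

lemma sub_node [simp]: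
  "h \<noteq> \<zero> \<Longrightarrow> \<not> (h = nm 18 \<and> l = v) \<Longrightarrow> sub (pr h (pr l r)) y v = pr h (pr (sub l y v) (sub r y v))"
  using axioms(17) zero_or_suc[of h] by metis

lemma sub_simps [simp]:
  "sub \<zero> y v = \<zero>" "sub (var z) y (var z) = y" "z \<noteq> z' \<Longrightarrow> sub (var z) y (var z') = var z" "sub (nd 18 v r) y v = nd 18 v r"
  using axioms(12,13,16) axioms(14)[of z "var z'"] by auto

text \<open>As \<open>d\<close> may be nonstandard, the induction takes place in the model. The same
  applies to the other facts about \<open>numc\<close>.\<close>

lemma sub_numc [simp]: "sub (numc d) y v = numc d"
  using model_induct[of "Eq (Sub (num (V 0)) (V 1) (V 2)) (num (V 0))" "(\<lambda>_. y)(2 := v)" 0 d] by simp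

lemma sub_code_tm:
  "i \<in> B \<Longrightarrow> sub (code_tm e B t) (numc d) (var (nm i)) = code_tm (e(i := d)) (B - {i}) t"
  by (induction t) auto

text \<open>Formal substitution of a numeral turns \<open>i\<close> from a retained variable into an
  evaluated one. Under a quantifier binding \<open>i\<close> the substitution stops, and there the
  value of \<open>i\<close> does not affect the code.\<close>

lemma sub_code_fm:
  "i \<in> B \<Longrightarrow> sub (code_fm e B \<phi>) (numc d) (var (nm i)) = code_fm (e(i := d)) (B - {i}) \<phi>"
proof (induction \<phi> arbitrary: B)
  case (All j \<phi>)
  show ?case
  proof (cases "j = i")
    case True
    have "code_fm e (insert i B) \<phi> = code_fm (e(i := d)) (insert i (B - {i})) \<phi>"
      by (rule code_fm_cong) auto
    then show ?thesis using True by (simp del: fun_upd_apply)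
  next
    case False
    then have "insert j (B - {i}) = insert j B - {i}" by auto
    then show ?thesis using All False by simp
  qed
qed (simp_all add: sub_code_tm)

section \<open>Free variables and well-formedness of codes\<close>

lemma isfree_zero [simp]: "\<not> isfree w \<zero>"
  using axioms(19)[of w] by simp

lemma isfree_pr_zero [simp]: "h \<noteq> \<zero> \<Longrightarrow> \<not> isfree w (pr h \<zero>)"
  using axioms(21)[of w] zero_or_suc[of h] by auto

lemma isfree_node:
  assumes "isfree w (pr h (pr l r))" "h \<noteq> \<zero>"
  shows "(isfree w l \<or> isfree w r) \<and> \<not> (h = nm 18 \<and> l = w)"
proof -
  have "\<not> (h = nm 18 \<and> l = w)" using assms(1) axioms(22)[of w r] by auto
  moreover obtain k where "h = suc k" using zero_or_suc assms(2) by blast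
  ultimately show ?thesis using axioms(23)[of k l w r] assms(1) by blast
qed

lemma isfree_var: "isfree w (var z) \<Longrightarrow> w = var z"
  using axioms(20) by blast

lemma isfree_numc [simp]: "\<not> isfree w (numc d)"
proof -
  have "sat M ((\<lambda>_. w)(0 := d)) (Neg (Free (V 1) (num (V 0))))"
    by (rule model_induct) (auto dest: isfree_node)
  then show ?thesis by simp
qed

lemma isfree_code_tm: "isfree w (code_tm e B t) \<Longrightarrow> \<exists>i\<in>B \<inter> tv t. w = var (nm i)"
  by (induction t) (auto dest!: isfree_node isfree_var split: if_splits)

lemma isfree_code_fm: "isfree w (code_fm e B \<phi>) \<Longrightarrow> \<exists>i\<in>B \<inter> fv \<phi>. w = var (nm i)"
proof (induction \<phi> arbitrary: B)
  case (All i \<phi>)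
  then have "isfree w (var (nm i)) \<or> isfree w (code_fm e (insert i B) \<phi>)" "w \<noteq> var (nm i)"
    using isfree_node[of w "nm 18"] by auto
  then show ?case using All.IH[of "insert i B"] isfree_var by fastforce
qed (auto dest!: isfree_node isfree_code_tm)

text \<open>The bound \<open>y\<close> may be nonstandard; by induction in the model every summand
  of the count vanishes.\<close>

lemma cnt_zero:
  assumes "\<And>w. \<not> isfree w x"
  shows "cnt y x = \<zero>"
proof -
  have free: "fun2 M FreeF w x = \<zero>" for w using assms axioms(18) by blast
  have "sat M ((\<lambda>_. x)(0 := y)) (Eq (F2 CntF (V 0) (V 1)) Zero)"
    by (rule model_induct) (simp_all add: free axioms(3,24,25))
  then show ?thesis by simp
qed

lemma isterm_node: "h \<noteq> \<zero> \<Longrightarrow> isterm (pr h (pr l r)) \<longleftrightarrow>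
     (\<exists>f. h = nm (tag1 f)) \<and> isterm l \<and> r = \<zero> \<or> (\<exists>f. h = nm (tag2 f)) \<and> isterm l \<and> isterm r"
proof -
  assume "h \<noteq> \<zero>"
  then obtain k where "h = suc k" using zero_or_suc by blast
  then show ?thesis by (simp only: isterm_node_iff)
qed

lemma isterm_zero [simp]: "isterm (pr \<one> \<zero>)"
  using axioms(28)[of \<zero>] by simp

lemma isterm_numc [simp]: "isterm (numc d)"
proof -
  have tag: "\<exists>f. tag1 f = 2" by (rule exI[of _ SucF]) simp
  have "sat M ((\<lambda>_. d)(0 := d)) (IsTerm (num (V 0)))"
    by (rule model_induct) (simp_all add: isterm_node tag)
  then show ?thesis by simp
qed

lemma isterm_code: "isterm (code_tm e B t)"
  by (induction t) (auto simp: isterm_node axioms(27))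

lemma isfml_node: "h \<noteq> \<zero> \<Longrightarrow> isfml (pr h (pr l r)) \<longleftrightarrow>
     h = nm 14 \<and> isterm l \<and> isterm r \<or> h = nm 15 \<and> isterm l \<and> r = \<zero> \<or>
     h = nm 16 \<and> isfml l \<and> r = \<zero> \<or> h = nm 17 \<and> isfml l \<and> isfml r \<or>
     h = nm 18 \<and> isvar l \<and> isfml r"
proof -
  assume "h \<noteq> \<zero>"
  then obtain k where "h = suc k" using zero_or_suc by blast
  then show ?thesis by (simp only: isfml_node_iff)
qed

lemma isfml_code: "isfml (code_fm e B \<phi>)"
  by (induction \<phi> arbitrary: B) (simp_all add: isfml_node isterm_code axioms(26))

text \<open>With \<open>B\<close> empty all variables have been replaced by numerals, so the model
  regards the code as closed even when some numerals are nonstandard.\<close>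

lemma ClTerm_code: "isterm (code_tm e {} t) \<and> cnt (code_tm e {} t) (code_tm e {} t) = \<zero>"
  using isfree_code_tm by (auto simp: isterm_code intro!: cnt_zero)

lemma Sent_code: "isfml (code_fm e {} \<phi>) \<and> cnt (code_fm e {} \<phi>) (code_fm e {} \<phi>) = \<zero>"
  using isfree_code_fm by (auto simp: isfml_code intro!: cnt_zero)

end

lemma arithmetical_EvalList: "arithmetical (EvalList c)"
  by (simp add: EvalList_def Let_def arithmetical_Disj)

lemma arithmetical_Val: "arithmetical (Val x y)"
  by (simp add: Val_def Let_def arithmetical_EvalList)

context kf_model
begin

section \<open>Evaluation of closed terms in a model\<close>

definition evlist :: "'a \<Rightarrow> bool" where
  "evlist c \<longleftrightarrow> (\<forall>t y. mem (pr t y) c \<longrightarrow>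
     t = pr \<one> \<zero> \<and> y = \<zero> \<or>
     (\<exists>f t1 y1. mem (pr t1 y1) c \<and> t = nd (tag1 f) t1 \<zero> \<and> y = fun1 M f y1) \<or>
     (\<exists>f t1 y1 t2 y2. mem (pr t1 y1) c \<and> mem (pr t2 y2) c \<and> t = nd (tag2 f) t1 t2 \<and> y = fun2 M f y1 y2))"

definition val :: "'a \<Rightarrow> 'a \<Rightarrow> bool" where
  "val t y \<longleftrightarrow> (\<exists>c. evlist c \<and> mem (pr t y) c)"

lemma sat_EvalList: "sat M e (EvalList c) \<longleftrightarrow> evlist (e c)"
proof -
  have ex1: "(\<exists>f\<in>set [SucF, NumF, VarF, TermF, FmlF]. P f) \<longleftrightarrow> (\<exists>f. P f)" for P
    using UNIV_fn1 by auto
  have ex2: "(\<exists>f\<in>set [AddF, MulF, ConsF, MemF, SubF, FreeF, CntF]. P f) \<longleftrightarrow> (\<exists>f. P f)" for P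
    using UNIV_fn2 by auto
  have q: "ev M e' (quote_tm Zero) = pr \<one> \<zero>" for e'
    using pr_nm[of 1 0] by (simp add: quote_tm_def)
  have disj: "sat M e' (Disj (\<phi> # map F [SucF, NumF, VarF, TermF, FmlF] @
        map G [AddF, MulF, ConsF, MemF, SubF, FreeF, CntF]))
      \<longleftrightarrow> sat M e' \<phi> \<or> (\<exists>f. sat M e' (F f)) \<or> (\<exists>f. sat M e' (G f))" for e' \<phi> F G
    unfolding ex1[symmetric] ex2[symmetric] by (auto simp: sat_Disj)
  show ?thesis
    unfolding EvalList_def Let_def sat.simps disj by (simp add: q evlist_def del: ex_simps all_simps) blast
qed

lemma sat_Val: "sat M e (Val x y) \<longleftrightarrow> val (ev M e x) (ev M e y)"
proof -
  let ?c = "fresh [x, y]"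
  have "?c \<notin> tv x" "?c \<notin> tv y" by (rule fresh_notin; simp)+
  then have "ev M (e(?c := d)) x = ev M e x" "ev M (e(?c := d)) y = ev M e y" for d
    by (auto intro!: ev_cong)
  then show ?thesis by (simp add: Val_def Let_def sat_EvalList val_def)
qed

lemma sat_with_val:
  "sat M e (with_val x ts A) \<longleftrightarrow>
    (\<exists>d. val (ev M e x) d \<and> sat M (e(fresh (x # ts) := d)) (A (V (fresh (x # ts)))))"
proof -
  let ?z = "fresh (x # ts)"
  have "?z \<notin> tv x" by (rule fresh_notin) simp
  then have "ev M (e(?z := d)) x = ev M e x" for d
    by (auto intro!: ev_cong)
  then show ?thesis by (simp add: with_val_def Let_def sat_Val)
qed

lemma sat_eq_val: "sat M e (eq_val x y) \<longleftrightarrow> (\<exists>a. val (ev M e x) a \<and> val (ev M e y) a)"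
proof -
  let ?z = "fresh [x, y]"
  have "?z \<notin> tv y" by (rule fresh_notin) simp
  then have y: "ev M (e(?z := d)) y = ev M e y" for d by (auto intro!: ev_cong)
  have "fresh [y, V ?z] \<notin> tv (V ?z)" by (rule fresh_notin) simp
  then show ?thesis by (auto simp: eq_val_def sat_with_val y)
qed

text \<open>Binary symbols need the values of both arguments in one list. Demanding that every
  evaluation list can be extended to one with the new entry lets two extensions be performed in
  succession, so lists are never concatenated.\<close>

definition evaluable :: "'a \<Rightarrow> 'a \<Rightarrow> bool" where
  "evaluable t y \<longleftrightarrow> (\<forall>c. evlist c \<longrightarrow> (\<exists>c'. evlist c' \<and> (\<forall>p. mem p c \<longrightarrow> mem p c') \<and> mem (pr t y) c'))"

lemma mem_pr [simp]: "mem x (pr y z) \<longleftrightarrow> x = y \<or> mem x z"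
  using axioms(8)[of x z] axioms(9)[of x y z] by auto

lemma mem_zero [simp]: "\<not> mem x \<zero>"
  using axioms(7)[of x] by simp

lemma evlist_pr:
  assumes "evlist c"
    "t = pr \<one> \<zero> \<and> y = \<zero> \<or>
     (\<exists>f t1 y1. mem (pr t1 y1) c \<and> t = nd (tag1 f) t1 \<zero> \<and> y = fun1 M f y1) \<or>
     (\<exists>f t1 y1 t2 y2. mem (pr t1 y1) c \<and> mem (pr t2 y2) c \<and> t = nd (tag2 f) t1 t2 \<and> y = fun2 M f y1 y2)"
  shows "evlist (pr (pr t y) c)"
  unfolding evlist_def
proof (intro allI impI)
  fix t' y'
  assume "mem (pr t' y') (pr (pr t y) c)"
  then have "t' = pr \<one> \<zero> \<and> y' = \<zero> \<or>
     (\<exists>f t1 y1. mem (pr t1 y1) c \<and> t' = nd (tag1 f) t1 \<zero> \<and> y' = fun1 M f y1) \<or>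
     (\<exists>f t1 y1 t2 y2. mem (pr t1 y1) c \<and> mem (pr t2 y2) c \<and> t' = nd (tag2 f) t1 t2 \<and> y' = fun2 M f y1 y2)"
    using assms unfolding evlist_def mem_pr pr_eq by blast
  then show "t' = pr \<one> \<zero> \<and> y' = \<zero> \<or>
     (\<exists>f t1 y1. mem (pr t1 y1) (pr (pr t y) c) \<and> t' = nd (tag1 f) t1 \<zero> \<and> y' = fun1 M f y1) \<or>
     (\<exists>f t1 y1 t2 y2. mem (pr t1 y1) (pr (pr t y) c) \<and> mem (pr t2 y2) (pr (pr t y) c) \<and>
        t' = nd (tag2 f) t1 t2 \<and> y' = fun2 M f y1 y2)"
    unfolding mem_pr by blast
qed

lemma evaluable_step:
  assumes "evlist c'" "\<forall>p. mem p c \<longrightarrow> mem p c'"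
    "t = pr \<one> \<zero> \<and> y = \<zero> \<or>
     (\<exists>f t1 y1. mem (pr t1 y1) c' \<and> t = nd (tag1 f) t1 \<zero> \<and> y = fun1 M f y1) \<or>
     (\<exists>f t1 y1 t2 y2. mem (pr t1 y1) c' \<and> mem (pr t2 y2) c' \<and> t = nd (tag2 f) t1 t2 \<and> y = fun2 M f y1 y2)"
  shows "\<exists>c'. evlist c' \<and> (\<forall>p. mem p c \<longrightarrow> mem p c') \<and> mem (pr t y) c'"
  using evlist_pr[OF assms(1,3)] assms(2) by (intro exI[of _ "pr (pr t y) c'"]) simp

lemma evaluable_zero: "evaluable (pr \<one> \<zero>) \<zero>"
  unfolding evaluable_def by (blast intro: evaluable_step)

lemma evaluable_F1:
  assumes "evaluable t y"
  shows "evaluable (nd (tag1 f) t \<zero>) (fun1 M f y)"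
  unfolding evaluable_def
proof (intro allI impI)
  fix c assume "evlist c"
  then obtain c' where c': "evlist c'" "\<forall>p. mem p c \<longrightarrow> mem p c'" "mem (pr t y) c'"
    using assms unfolding evaluable_def by blast
  show "\<exists>c'. evlist c' \<and> (\<forall>p. mem p c \<longrightarrow> mem p c') \<and> mem (pr (nd (tag1 f) t \<zero>) (fun1 M f y)) c'"
    by (rule evaluable_step[OF c'(1,2)]) (use c'(3) in blast)
qed

lemma evaluable_F2:
  assumes "evaluable t1 y1" "evaluable t2 y2"
  shows "evaluable (nd (tag2 f) t1 t2) (fun2 M f y1 y2)"
  unfolding evaluable_def
proof (intro allI impI)
  fix c assume "evlist c"
  then obtain c1 where c1: "evlist c1" "\<forall>p. mem p c \<longrightarrow> mem p c1" "mem (pr t1 y1) c1"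
    using assms(1) unfolding evaluable_def by blast
  then obtain c2 where c2: "evlist c2" "\<forall>p. mem p c1 \<longrightarrow> mem p c2" "mem (pr t2 y2) c2"
    using assms(2) unfolding evaluable_def by blast
  have sub: "\<forall>p. mem p c \<longrightarrow> mem p c2" using c1(2) c2(2) by blast
  have m: "mem (pr t1 y1) c2" using c1(3) c2(2) by blast
  show "\<exists>c'. evlist c' \<and> (\<forall>p. mem p c \<longrightarrow> mem p c') \<and> mem (pr (nd (tag2 f) t1 t2) (fun2 M f y1 y2)) c'"
    by (rule evaluable_step[OF c2(1) sub]) (use c2(3) m in blast)
qed

text \<open>The numeral of a nonstandard element has no standard construction. Evaluability is
  expressed by an arithmetical formula, so induction on \<open>d\<close> in the model
  applies.\<close>

lemma evaluable_numc: "evaluable (numc d) d"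
proof -
  let ?\<phi> = "All 1 (Imp (EvalList 1) (Exi 2 (And (EvalList 2)
     (And (All 3 (Imp (Mem (V 3) (V 1)) (Mem (V 3) (V 2)))) (Mem (Pr (num (V 0)) (V 0)) (V 2))))))"
  have \<phi>: "sat M ((\<lambda>_. d)(0 := x)) ?\<phi> \<longleftrightarrow> evaluable (numc x) x" for x
    by (simp add: sat_EvalList evaluable_def)
  have "sat M ((\<lambda>_. d)(0 := d)) ?\<phi>"
  proof (rule model_induct)
    show "arithmetical ?\<phi>" by (simp add: arithmetical_EvalList)
  next
    show "sat M ((\<lambda>_. d)(0 := \<zero>)) ?\<phi>" unfolding \<phi> using evaluable_zero by simp
  next
    show "sat M ((\<lambda>_. d)(0 := x)) ?\<phi> \<Longrightarrow> sat M ((\<lambda>_. d)(0 := suc x)) ?\<phi>" for x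
      unfolding \<phi> using evaluable_F1[of "numc x" x SucF] by simp
  qed
  then show ?thesis unfolding \<phi> .
qed

lemma evaluable_code: "evaluable (code_tm e {} t) (ev M e t)"
  using evaluable_zero by (induction t) (auto intro: evaluable_F1 evaluable_F2 evaluable_numc)

lemma evlist_zero: "evlist \<zero>"
  by (simp add: evlist_def)

lemma val_code: "val (code_tm e {} t) (ev M e t)"
  using evaluable_code evlist_zero unfolding evaluable_def val_def by blast

text \<open>The entries for the immediate subterms lie in the same list, which therefore witnesses
  their values too. Uniqueness of values then follows by inverting one evaluation step at a
  time.\<close>

lemma val_cases:
  assumes "val t y"
  obtains "t = pr \<one> \<zero>" "y = \<zero>"
  | f t1 y1 where "val t1 y1" "t = nd (tag1 f) t1 \<zero>" "y = fun1 M f y1"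
  | f t1 y1 t2 y2 where "val t1 y1" "val t2 y2" "t = nd (tag2 f) t1 t2" "y = fun2 M f y1 y2"
proof -
  obtain c where c: "evlist c" "mem (pr t y) c" using assms unfolding val_def by blast
  then have "t = pr \<one> \<zero> \<and> y = \<zero> \<or>
     (\<exists>f t1 y1. mem (pr t1 y1) c \<and> t = nd (tag1 f) t1 \<zero> \<and> y = fun1 M f y1) \<or>
     (\<exists>f t1 y1 t2 y2. mem (pr t1 y1) c \<and> mem (pr t2 y2) c \<and> t = nd (tag2 f) t1 t2 \<and> y = fun2 M f y1 y2)"
    unfolding evlist_def by blast
  moreover have "val t' y'" if "mem (pr t' y') c" for t' y' using c that unfolding val_def by blast
  ultimately show ?thesis using that by metis
qed

lemma val_zeroD: "val (pr \<one> \<zero>) y \<Longrightarrow> y = \<zero>"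
  by (erule val_cases) simp_all

lemma val_F1D: "val (nd (tag1 f) t \<zero>) y \<Longrightarrow> \<exists>z. val t z \<and> y = fun1 M f z"
  by (erule val_cases) auto

lemma val_F2D: "val (nd (tag2 f) s t) y \<Longrightarrow> \<exists>a b. val s a \<and> val t b \<and> y = fun2 M f a b"
  by (erule val_cases) auto

lemma val_numcD: "val (numc d) y \<Longrightarrow> y = d"
proof -
  let ?\<phi> = "All 1 (Imp (Val (num (V 0)) (V 1)) (Eq (V 1) (V 0)))"
  have \<phi>: "sat M ((\<lambda>_. d)(0 := x)) ?\<phi> \<longleftrightarrow> (\<forall>y. val (numc x) y \<longrightarrow> y = x)" for x
    by (simp add: sat_Val)
  have "sat M ((\<lambda>_. d)(0 := d)) ?\<phi>"
  proof (rule model_induct)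
    show "arithmetical ?\<phi>" by (simp add: arithmetical_Val)
  next
    show "sat M ((\<lambda>_. d)(0 := \<zero>)) ?\<phi>" unfolding \<phi> using val_zeroD by simp
  next
    show "sat M ((\<lambda>_. d)(0 := x)) ?\<phi> \<Longrightarrow> sat M ((\<lambda>_. d)(0 := suc x)) ?\<phi>" for x
      unfolding \<phi> using val_F1D[of SucF "numc x"] by auto
  qed
  then show "val (numc d) y \<Longrightarrow> y = d" unfolding \<phi> by blast
qed

lemma val_codeD: "val (code_tm e {} t) y \<Longrightarrow> y = ev M e t"
proof (induction t arbitrary: y)
  case Zero
  then show ?case using val_zeroD by simp
next
  case (F1 f t)
  then show ?case using val_F1D by fastforce
next
  case (F2 f s t)
  then show ?case using val_F2D by fastforce
qed (simp add: val_numcD)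

lemma val_code_iff [simp]: "val (code_tm e {} t) y \<longleftrightarrow> y = ev M e t"
  using val_code val_codeD by blast

section \<open>Truth in a model\<close>

abbreviation clterm :: "'a \<Rightarrow> bool" where "clterm x \<equiv> isterm x \<and> cnt x x = \<zero>"
abbreviation sent :: "'a \<Rightarrow> bool" where "sent x \<equiv> isfml x \<and> cnt x x = \<zero>"
abbreviation true :: "'a \<Rightarrow> bool" where "true x \<equiv> x \<in> truth M"

lemma initial_sat: "inference K I [] S \<Longrightarrow> sequent_sat M e S"
  by (rule derivable_sat) (auto intro: derivable_step)

text \<open>With an identity sequent as premise a rule becomes the corresponding axiom.\<close>

lemma rule_sat:
  assumes "inference K I [\<Gamma> \<Turnstile> \<Delta>] S" "\<phi> |\<in>| \<Gamma>" "\<phi> |\<in>| \<Delta>"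
  shows "sequent_sat M e S"
  by (intro derivable_sat derivable_step[OF assms(1)]) (simp add: derivable_identity[OF assms(2,3)])

lemma rule2_sat:
  assumes "inference K I [\<Gamma> \<Turnstile> \<Delta>, \<Gamma>' \<Turnstile> \<Delta>'] S" "\<phi> |\<in>| \<Gamma>" "\<phi> |\<in>| \<Delta>" "\<psi> |\<in>| \<Gamma>'" "\<psi> |\<in>| \<Delta>'"
  shows "sequent_sat M e S"
  by (intro derivable_sat derivable_step[OF assms(1)]) (simp add: derivable_identity[OF assms(2,3)] derivable_identity[OF assms(4,5)])

lemma true_eq:
  assumes "clterm x" "clterm y"
  shows "true (nd 14 x y) \<longleftrightarrow> (\<exists>a. val x a \<and> val y a)"
    and "true (nd 16 (nd 14 x y) \<zero>) \<longleftrightarrow> \<not> (\<exists>a. val x a \<and> val y a)"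
proof -
  let ?e = "(\<lambda>_. x)(1 := y)"
  note ax = initial_sat[OF TEq1[of _ _ "V 0" "V 1" "{||}" "{||}"], of ?e]
    initial_sat[OF TEq2[of _ _ "V 0" "V 1" "{||}" "{||}"], of ?e]
    initial_sat[OF TNeq1[of _ _ "V 0" "V 1" "{||}" "{||}"], of ?e]
    initial_sat[OF TNeq2[of _ _ "V 0" "V 1" "{||}" "{||}"], of ?e]
  show "true (nd 14 x y) \<longleftrightarrow> (\<exists>a. val x a \<and> val y a)"
    using ax(1,2) assms by (auto simp: ClTerm_def sat_eq_val)
  show "true (nd 16 (nd 14 x y) \<zero>) \<longleftrightarrow> \<not> (\<exists>a. val x a \<and> val y a)"
    using ax(3,4) assms by (auto simp: ClTerm_def sat_eq_val)
qed

lemma true_tr: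
  assumes "clterm x"
  shows "true (nd 15 x \<zero>) \<longleftrightarrow> (\<exists>a. val x a \<and> true a)"
proof -
  let ?A = "with_val (V 0) [] Tr"
  have "sequent_sat M (\<lambda>_. x) ({|ClTerm (V 0), Tr (dtr (V 0))|} |\<union>| {||} \<Turnstile> {|?A|})"
    by (rule rule_sat[where \<phi>="?A", OF TTL]) simp_all
  moreover have "sequent_sat M (\<lambda>_. x) (finsert (ClTerm (V 0)) {|?A|} \<Turnstile> finsert (Tr (dtr (V 0))) {||})"
    by (rule rule_sat[where \<phi>="?A", OF TTR]) simp_all
  ultimately show ?thesis using assms by (auto simp: ClTerm_def sat_with_val)
qed

lemma true_negneg:
  assumes "sent x"
  shows "true (nd 16 (nd 16 x \<zero>) \<zero>) \<longleftrightarrow> true x"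
proof -
  let ?A = "Tr (V 0)"
  have "sequent_sat M (\<lambda>_. x) ({|Sent (V 0), Tr (dneg (dneg (V 0)))|} |\<union>| {||} \<Turnstile> {|?A|})"
    by (rule rule_sat[where \<phi>="?A", OF TNegNegL]) simp_all
  moreover have "sequent_sat M (\<lambda>_. x) (finsert (Sent (V 0)) {|?A|} \<Turnstile> finsert (Tr (dneg (dneg (V 0)))) {||})"
    by (rule rule_sat[where \<phi>="?A", OF TNegNegR]) simp_all
  ultimately show ?thesis using assms by (auto simp: Sent_def)
qed

lemma true_and:
  assumes "sent (nd 17 x y)"
  shows "true (nd 17 x y) \<longleftrightarrow> true x \<and> true y"
proof -
  let ?e = "(\<lambda>_. x)(1 := y)"
  let ?x = "V 0" and ?y = "V 1"
  have 1: "sequent_sat M ?e ({|Sent (dand ?x ?y), Tr (dand ?x ?y)|} |\<union>| {||} \<Turnstile> {|Tr ?x|})"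
    by (rule rule_sat[where \<phi>="Tr ?x", OF TAndL]) simp_all
  have 2: "sequent_sat M ?e ({|Sent (dand ?x ?y), Tr (dand ?x ?y)|} |\<union>| {||} \<Turnstile> {|Tr ?y|})"
    by (rule rule_sat[where \<phi>="Tr ?y", OF TAndL]) simp_all
  have 3: "sequent_sat M ?e (finsert (Sent (dand ?x ?y)) {|Tr ?x, Tr ?y|} \<Turnstile> finsert (Tr (dand ?x ?y)) {||})"
    by (rule rule2_sat[where \<phi>="Tr ?x" and \<psi>="Tr ?y", OF TAndR]) simp_all
  show ?thesis
    using assms 1[unfolded Sent_def, simplified] 2[unfolded Sent_def, simplified]
      3[unfolded Sent_def, simplified] by blast
qed

lemma true_neg_and:
  assumes "sent (nd 17 x y)"
  shows "true (nd 16 (nd 17 x y) \<zero>) \<longleftrightarrow> true (nd 16 x \<zero>) \<or> true (nd 16 y \<zero>)"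
proof -
  let ?e = "(\<lambda>_. x)(1 := y)"
  let ?x = "V 0" and ?y = "V 1"
  let ?D = "{|Tr (dneg ?x), Tr (dneg ?y)|}"
  have 1: "sequent_sat M ?e ({|Sent (dand ?x ?y), Tr (dneg (dand ?x ?y))|} |\<union>| {||} \<Turnstile> ?D)"
    by (rule rule2_sat[where \<phi>="Tr (dneg ?x)" and \<psi>="Tr (dneg ?y)", OF TNegAndL]) simp_all
  have 2: "sequent_sat M ?e (finsert (Sent (dand ?x ?y)) {|Tr (dneg ?x)|} \<Turnstile> finsert (Tr (dneg (dand ?x ?y))) {||})"
    by (rule rule_sat[where \<phi>="Tr (dneg ?x)", OF TNegAndR]) simp_all
  have 3: "sequent_sat M ?e (finsert (Sent (dand ?x ?y)) {|Tr (dneg ?y)|} \<Turnstile> finsert (Tr (dneg (dand ?x ?y))) {||})"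
    by (rule rule_sat[where \<phi>="Tr (dneg ?y)", OF TNegAndR]) simp_all
  show ?thesis
    using assms 1[unfolded Sent_def, simplified] 2[unfolded Sent_def, simplified]
      3[unfolded Sent_def, simplified] by blast
qed

lemma true_all:
  assumes "sent (nd 18 v x)"
  shows "true (nd 18 v x) \<longleftrightarrow> (\<forall>d. true (sub x (numc d) v))"
proof -
  let ?e = "(\<lambda>_. x)(1 := v)"
  let ?x = "V 0" and ?v = "V 1"
  let ?A = "All 2 (Tr (Sub ?x (num (V 2)) ?v))"
  have "sequent_sat M ?e ({|Sent (dall ?v ?x), Tr (dall ?v ?x)|} |\<union>| {||} \<Turnstile> {|?A|})"
    by (rule rule_sat[where \<phi>="?A", OF TAllL[of 2]]) simp_all
  moreover have "sequent_sat M ?e (finsert (Sent (dall ?v ?x)) {|?A|} \<Turnstile> finsert (Tr (dall ?v ?x)) {||})"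
    by (rule rule_sat[where \<phi>="?A", OF TAllR[of 2]]) simp_all
  ultimately show ?thesis using assms by (auto simp: Sent_def)
qed

lemma true_neg_all:
  assumes "sent (nd 18 v x)"
  shows "true (nd 16 (nd 18 v x) \<zero>) \<longleftrightarrow> (\<exists>d. true (nd 16 (sub x (numc d) v) \<zero>))"
proof -
  let ?e = "(\<lambda>_. x)(1 := v)"
  let ?x = "V 0" and ?v = "V 1"
  let ?A = "Exi 2 (Tr (dneg (Sub ?x (num (V 2)) ?v)))"
  have "sequent_sat M ?e ({|Sent (dall ?v ?x), Tr (dneg (dall ?v ?x))|} |\<union>| {||} \<Turnstile> {|?A|})"
    by (rule rule_sat[where \<phi>="?A", OF TNegAllL[of 2]]) simp_all
  moreover have "sequent_sat M ?e (finsert (Sent (dall ?v ?x)) {|?A|} \<Turnstile> finsert (Tr (dneg (dall ?v ?x))) {||})"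
    by (rule rule_sat[where \<phi>="?A", OF TNegAllR[of 2]]) simp_all
  ultimately show ?thesis using assms by (auto simp: Sent_def)
qed

text \<open>The truth rules treat a negation according to the shape of the negated formula rather
  than as failure of truth, so both claims must be carried together. The assignment varies because
  an instance of a quantified formula is its matrix coded under a changed assignment.\<close>

lemma arithmetical_truth:
  "arithmetical \<phi> \<Longrightarrow> (true (code_fm e {} \<phi>) \<longleftrightarrow> sat M e \<phi>) \<and>
    (true (nd 16 (code_fm e {} \<phi>) \<zero>) \<longleftrightarrow> \<not> sat M e \<phi>)"
proof (induction \<phi> arbitrary: e)
  case (Eq s t)
  show ?case using true_eq[OF ClTerm_code ClTerm_code, of e s e t] by simp
next
  case (Neg \<phi>)
  then show ?case using true_negneg[OF Sent_code[of e \<phi>]] by simp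
next
  case (And \<phi> \<psi>)
  then show ?case
    using true_and[of "code_fm e {} \<phi>" "code_fm e {} \<psi>"]
      true_neg_and[of "code_fm e {} \<phi>" "code_fm e {} \<psi>"] Sent_code[of e "And \<phi> \<psi>"] by simp
next
  case (All i \<phi>)
  have "sub (code_fm e {i} \<phi>) (numc d) (var (nm i)) = code_fm (e(i := d)) {} \<phi>" for d
    using sub_code_fm[of i "{i}" e \<phi> d] by simp
  then show ?case
    using true_all[of "var (nm i)" "code_fm e {i} \<phi>"] true_neg_all[of "var (nm i)" "code_fm e {i} \<phi>"]
      Sent_code[of e "All i \<phi>"] All.IH All.prems by (simp del: fun_upd_apply)
qed simp

text \<open>Without free variables, neither the retained set nor the assignment affects the code, so
  \<open>UNIV\<close> may be exchanged for the empty set.\<close>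

lemma ev_quote_sentence:
  assumes "sentence \<phi>"
  shows "ev M e (quote_fm \<phi>) = code_fm e' {} \<phi>"
proof -
  have "code_fm e' UNIV \<phi> = code_fm e' {} \<phi>"
    by (rule code_fm_cong) (use assms in \<open>auto simp: sentence_def\<close>)
  then show ?thesis by (simp add: quote_fm_def nm_gn[of \<phi> e'])
qed

lemma sat_T_quote:
  "sentence \<phi> \<Longrightarrow> arithmetical \<phi> \<Longrightarrow> sat M e (Tr (quote_fm \<phi>)) \<longleftrightarrow> sat M e \<phi>"
  using arithmetical_truth[of \<phi> e] ev_quote_sentence[of \<phi> e e] by simp

text \<open>A quotation is a numeral, a closed term whose value is the Goedel number itself; the
  rules for the inner \<open>T\<close> thus remove one layer.\<close>

lemma sat_TT_quote: "sat M e (Tr (quote_fm (Tr (quote_fm \<phi>)))) \<longleftrightarrow> sat M e (Tr (quote_fm \<phi>))"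
proof -
  have "sentence (Tr (quote_fm \<phi>))" by (simp add: sentence_def quote_fm_def)
  then have "ev M e (quote_fm (Tr (quote_fm \<phi>))) = nd 15 (code_tm e {} (quote_fm \<phi>)) \<zero>"
    using ev_quote_sentence[of _ e e] by simp
  then show ?thesis using true_tr[OF ClTerm_code[of e "quote_fm \<phi>"]] by simp
qed

end

section \<open>Derivations within the significant inferences\<close>

lemma fv_foldr_All: "fv (foldr All vs \<phi>) = fv \<phi> - set vs"
  by (induction vs) auto

lemma arithmetical_foldr_All: "arithmetical (foldr All vs \<phi>) = arithmetical \<phi>"
  by (induction vs) auto

lemma sentence_univ_closure: "sentence (univ_closure \<phi>)"
  by (simp add: sentence_def univ_closure_def fv_foldr_All)

lemma arithmetical_subst: "arithmetical (subst \<phi> v t) = arithmetical \<phi>"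
  by (induction \<phi>) auto

lemma arithmetical_defining: "\<phi> \<in> defining_axioms \<Longrightarrow> arithmetical \<phi>"
  unfolding defining_axioms_def Let_def by (auto simp: arithmetical_Disj)

lemma pa_axiom_arithmetical: "pa_axiom \<phi> \<Longrightarrow> arithmetical \<phi>"
  by (induction rule: pa_axiom.induct)
    (auto simp: univ_closure_def arithmetical_foldr_All arithmetical_subst arithmetical_defining)

lemma pa_axiom_sentence: "pa_axiom \<phi> \<Longrightarrow> sentence \<phi>"
  by (induction rule: pa_axiom.induct) (auto intro: sentence_univ_closure)

lemma pa_axiom_in_SI:
  assumes "pa_axiom \<phi>"
  shows "sequent_in_SI K I ({||} \<Turnstile> {|\<phi>|})"
proof -
  have "derivable K I ({||} \<Turnstile> {|Tr (quote_fm \<phi>)|})"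
  proof (rule completeness)
    fix M :: "nat interp" and e
    assume "is_model K I M"
    then interpret kf_model K I M by unfold_locales
    show "sequent_sat M e ({||} \<Turnstile> {|Tr (quote_fm \<phi>)|})"
      using pa_sat[OF assms] sat_T_quote pa_axiom_arithmetical[OF assms] pa_axiom_sentence[OF assms]
      by simp
  qed
  then show ?thesis
    using pa_axiom_sentence[OF assms] by (simp add: T_quote_dot_def quote_dot_sentence)
qed

text \<open>In each model the corresponding formulae of the two sequents are equivalent one by
  one.\<close>

lemma derivable_T_quote:
  assumes "derivable K I (T_quote \<Gamma> \<Turnstile> T_quote \<Delta>)"
  shows "derivable K I (T_quote (T_quote \<Gamma>) \<Turnstile> T_quote (T_quote \<Delta>))"
proof (rule completeness)
  fix M :: "nat interp" and e
  assume "is_model K I M"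
  then interpret kf_model K I M by unfold_locales
  show "sequent_sat M e (T_quote (T_quote \<Gamma>) \<Turnstile> T_quote (T_quote \<Delta>))"
    using derivable_sat[OF assms, of e] sat_TT_quote[of e] by (simp add: T_quote_def)
qed

text \<open>The added formulae are sentences, so inserting numerals leaves their quotations alone;
  whatever open formulae accompany them enter by weakening.\<close>

lemma above_in_SI:
  assumes "derivable K I (T_quote \<Gamma> \<Turnstile> T_quote \<Delta>)" "T_quote \<Gamma> |\<subseteq>| \<Gamma>'" "T_quote \<Delta> |\<subseteq>| \<Delta>'"
  shows "sequent_in_SI K I (\<Gamma>' \<Turnstile> \<Delta>')"
proof -
  have dot: "T_quote_dot (T_quote \<Theta>) = T_quote (T_quote \<Theta>)" for \<Theta>
  proof -
    have "sentence \<phi>" if "\<phi> |\<in>| T_quote \<Theta>" for \<phi>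
      using that by (auto simp: T_quote_def sentence_def quote_fm_def)
    then show ?thesis unfolding T_quote_dot_def T_quote_def[of "T_quote \<Theta>"]
      by (intro fset.map_cong) (auto simp: quote_dot_sentence)
  qed
  have mono: "\<Theta> |\<subseteq>| \<Theta>' \<Longrightarrow> T_quote_dot \<Theta> |\<subseteq>| T_quote_dot \<Theta>'" for \<Theta> \<Theta>'
    unfolding T_quote_dot_def by (rule fimage_mono)
  show ?thesis
    using derivable_weaken[OF derivable_T_quote[OF assms(1)]] mono[OF assms(2)] mono[OF assms(3)]
    by (simp add: dot)
qed

theorem proposition4p18:
  fixes K :: truth_theory and I :: induction_version and \<Gamma> \<Delta> :: "fm fset"
  assumes "(\<Gamma>, \<Delta>) \<in> SI K I"
  shows "\<exists>D. is_derivation K I D \<and> label D = (T_quote \<Gamma> \<Turnstile> T_quote \<Delta>) \<and>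
             (\<forall>d\<in>set_dtree D. sequent_in_SI K I d)"
proof -
  let ?C = "T_quote \<Gamma>" and ?D = "T_quote \<Delta>"
  have der: "derivable K I (?C \<Turnstile> ?D)" using assms by (simp add: SI_def)
  note above = above_in_SI[OF der]
  have closed: "fvs (T_quote \<Theta>) = {}" for \<Theta>
    by (auto simp: fvs_def T_quote_def quote_fm_def)
  have "der K I (\<lambda>_. True) S \<Longrightarrow> der K I (sequent_in_SI K I) (weaken ?C ?D S)" for S
  proof (induction rule: der.induct)
    case (der_step Ps S)
    have in_SI: "sequent_in_SI K I (weaken ?C ?D S)"
      by (cases S) (simp only: weaken_simps, rule above, auto)
    consider "inference K I (map (weaken ?C ?D) Ps) (weaken ?C ?D S)"
      | \<phi> where "pa_axiom \<phi>" "S = ({||} \<Turnstile> {|\<phi>|})"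
      using inference_weaken[OF der_step.hyps(1) closed closed] by blast
    then show ?case
    proof cases
      case 1
      then show ?thesis using der_step.IH in_SI by (intro der.der_step[OF 1]) auto
    next
      case (2 \<phi>)
      have "der K I (sequent_in_SI K I) ({||} \<Turnstile> {|\<phi>|})"
        using 2 pa_axiom_in_SI by (intro der.der_step[OF PA]) auto
      \<comment> \<open>An arithmetical axiom is restored to its weakened form by cutting it against
        an identity sequent; its right-hand copy survives the cut.\<close>
      moreover have "der K I (sequent_in_SI K I) (finsert \<phi> ?C \<Turnstile> finsert \<phi> ?D)"
        by (rule der_identity) (rule above)
      ultimately have "der K I (sequent_in_SI K I) (?C |\<union>| {||} \<Turnstile> {||} |\<union>| finsert \<phi> ?D)"
        using in_SI 2 by (intro der.der_step[OF Cut[of _ _ _ \<phi>]]) auto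
      then show ?thesis using 2 by simp
    qed
  qed
  \<comment> \<open>The given end sequent already consists of the added formulae, so weakening
    leaves the root unchanged.\<close>
  from this[of "?C \<Turnstile> ?D"] der show ?thesis
    by (simp add: derivable_iff_der der_iff_derivation)
qed

end
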